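(* Fix integers $d\ge 1$ and $h$ with $d \leq h \leq 2d-2$. For $n\ge 1$ let $T_{n}$ be the set of sites in $\mathbb{Z}^d$ that topple during the stabilization of the configuration $\overline{h}+n\delta_o$. Then for any $\epsilon>0$, we have $T_{n} \subset Q_r$ for all sufficiently large $n$, where \[ r = \frac{d+\epsilon}{2d-1-h}\left(\frac{n}{\omega_d}\right)^{1/d}. \]
   Context: Abelian sandpile on $\mathbb{Z}^d$: a configuration is a function $\eta:\mathbb{Z}^d\to\mathbb{Z}$ (number of particles at each site). A site $x$ is unstable if $\eta(x)\ge 2d$; toppling $x$ sends one particle from $x$ to each of its $2d$ lattice neighbours. A configuration is stable if $\eta\le 2d-1$ everywhere. Stabilization means repeatedly toppling unstable sites until none remain (e.g. enumerate the sites of $\mathbb{Z}^d$ and at each time step topple the smallest unstable site); the set of sites that topple does not depend on the legal order chosen. $\overline{h}$ denotes the constant configuration $\sigma(x)\equiv h$, and $\delta_o$ a single particle at the origin, so $\overline{h}+n\delta_o$ has $h$ particles at every site plus $n$ extra particles at the origin. $Q_r=\{x\in\mathbb{Z}^d : \max_i |x_i|\le r\}$, and $\omega_d$ is the volume of the unit ball in $\mathbb{R}^d$. *)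

theory Defs
  imports "HOL-Analysis.Analysis"
begin

text \<open>
  The lattice \<open>Z^d\<close> is the type \<open>int ^ 'd\<close> with \<open>d = CARD('d)\<close>.
\<close>

type_synonym 'd config = "int ^ 'd \<Rightarrow> int"

definition nbrs :: "int ^ 'd \<Rightarrow> (int ^ 'd) set" where
  "nbrs x = range (\<lambda>i. x + axis i 1) \<union> range (\<lambda>i. x - axis i 1)"

definition unstable :: "'d::finite config \<Rightarrow> int ^ 'd \<Rightarrow> bool" where
  "unstable \<eta> x \<longleftrightarrow> \<eta> x \<ge> 2 * int CARD('d)"

definition topple :: "int ^ 'd::finite \<Rightarrow> 'd config \<Rightarrow> 'd config" where
  "topple x \<eta> = (\<lambda>y. \<eta> y - (if y = x then 2 * int CARD('d) else 0) + (if y \<in> nbrs x then 1 else 0))"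

text \<open>
  A toppling order is a sequence \<open>s\<close>, where \<open>s t = Some x\<close> means that \<open>x\<close> topples at time \<open>t\<close>
  and \<open>s t = None\<close> that nothing happens, so that terminating and non-terminating
  stabilizations are treated uniformly. \<open>run \<sigma> s t\<close> is the configuration just before time \<open>t\<close>.
\<close>

primrec run :: "'d::finite config \<Rightarrow> (nat \<Rightarrow> (int ^ 'd) option) \<Rightarrow> nat \<Rightarrow> 'd config" where
  "run \<sigma> s 0 = \<sigma>"
| "run \<sigma> s (Suc t) = (case s t of None \<Rightarrow> run \<sigma> s t | Some x \<Rightarrow> topple x (run \<sigma> s t))"

definition legal :: "'d::finite config \<Rightarrow> (nat \<Rightarrow> (int ^ 'd) option) \<Rightarrow> bool" where
  "legal \<sigma> s \<longleftrightarrow> (\<forall>t x. s t = Some x \<longrightarrow> unstable (run \<sigma> s t) x)"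

text \<open>
  ``Until none remain'': every site that is unstable at some time is toppled then or later.
  If only finitely many topplings occur, this says that the final configuration is stable;
  if the process never ends, it rules out an order that neglects an unstable site forever.
\<close>

definition stabilizing :: "'d::finite config \<Rightarrow> (nat \<Rightarrow> (int ^ 'd) option) \<Rightarrow> bool" where
  "stabilizing \<sigma> s \<longleftrightarrow> legal \<sigma> s \<and>
     (\<forall>t x. unstable (run \<sigma> s t) x \<longrightarrow> (\<exists>t'\<ge>t. s t' = Some x))"

text \<open>
  The sites that topple during stabilization. By \<open>toppled_sites_eq\<close> below, every stabilizing
  order gives this same set; by \<open>stabilizing_greedy\<close>, toppling at each step the smallest
  unstable site with respect to an enumeration of \<open>Z^d\<close> is such an order.
\<close>

definition toppled_sites :: "'d::finite config \<Rightarrow> (int ^ 'd) set" where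
  "toppled_sites \<sigma> = {x. \<exists>s. stabilizing \<sigma> s \<and> Some x \<in> range s}"

definition const_plus_origin :: "int \<Rightarrow> nat \<Rightarrow> 'd::finite config" where
  "const_plus_origin h n = (\<lambda>x. h + (if x = 0 then int n else 0))"

definition cube :: "real \<Rightarrow> (int ^ 'd::finite) set" where
  "cube r = {x. real_of_int (MAX i. \<bar>x $ i\<bar>) \<le> r}"

subsection \<open>Independence of the order\<close>

lemma finite_nbrs [simp]: "finite (nbrs (x :: int ^ 'd::finite))"
  by (simp add: nbrs_def)

lemma card_nbrs_le: "card (nbrs (x :: int ^ 'd::finite)) \<le> 2 * CARD('d)"
proof -
  have "card (nbrs x) \<le> card (range (\<lambda>i. x + axis i 1)) + card (range (\<lambda>i. x - axis i 1))"
    unfolding nbrs_def by (rule card_Un_le)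
  also have "\<dots> \<le> CARD('d) + CARD('d)"
    by (intro add_mono card_image_le) auto
  finally show ?thesis by simp
qed

lemma nbrs_sym: "y \<in> nbrs x \<longleftrightarrow> x \<in> nbrs (y :: int ^ 'd)"
proof -
  have "x \<in> nbrs y" if "y \<in> nbrs x" for x y :: "int ^ 'd"
    using that by (force simp: nbrs_def image_iff algebra_simps)
  then show ?thesis by blast
qed

lemma nbrs_irrefl [simp]: "(x :: int ^ 'd::finite) \<notin> nbrs x"
  by (auto simp: nbrs_def)

definition topplings :: "(nat \<Rightarrow> (int ^ 'd) option) \<Rightarrow> nat \<Rightarrow> int ^ 'd \<Rightarrow> nat" where
  "topplings s t x = card {u. u < t \<and> s u = Some x}"

lemma topplings_0 [simp]: "topplings s 0 x = 0"
  by (simp add: topplings_def)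

lemma topplings_Suc:
  "topplings s (Suc t) x = topplings s t x + (if s t = Some x then 1 else 0)"
proof -
  have "{u. u < Suc t \<and> s u = Some x} =
        (if s t = Some x then insert t {u. u < t \<and> s u = Some x} else {u. u < t \<and> s u = Some x})"
    by (auto simp: less_Suc_eq)
  then show ?thesis by (simp add: topplings_def)
qed

lemma topplings_mono: "t \<le> t' \<Longrightarrow> topplings s t x \<le> topplings s t' x"
  unfolding topplings_def by (rule card_mono) auto

lemma topplings_pos_iff: "0 < topplings s t x \<longleftrightarrow> (\<exists>u<t. s u = Some x)"
  unfolding topplings_def by (auto simp: card_gt_0_iff)

lemma run_topplings:
  fixes \<sigma> :: "'d::finite config"
  shows "run \<sigma> s t x = \<sigma> x - 2 * int CARD('d) * int (topplings s t x)
           + (\<Sum>y\<in>nbrs x. int (topplings s t y))"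
proof (induction t)
  case 0
  then show ?case by simp
next
  case (Suc t)
  show ?case
  proof (cases "s t")
    case None
    then show ?thesis using Suc by (simp add: topplings_Suc)
  next
    case (Some z)
    have "(\<Sum>y\<in>nbrs x. int (topplings s (Suc t) y)) =
          (\<Sum>y\<in>nbrs x. int (topplings s t y)) + (\<Sum>y\<in>nbrs x. if z = y then 1 else 0)"
      unfolding sum.distrib [symmetric]
      by (intro sum.cong) (auto simp: topplings_Suc Some)
    also have "(\<Sum>y\<in>nbrs x. if z = y then 1 else 0) = (if z \<in> nbrs x then 1 else (0::int))"
      by (rule sum.delta') simp
    finally show ?thesis
      using Suc Some by (auto simp: topple_def topplings_Suc nbrs_sym [of x] algebra_simps)
  qed
qed

lemma legal_topplings_le:
  fixes \<sigma> :: "'d::finite config"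
  assumes "legal \<sigma> s" "stabilizing \<sigma> s'"
  shows "\<exists>t'. \<forall>x. topplings s t x \<le> topplings s' t' x"
proof (induction t)
  case 0
  then show ?case by simp
next
  case (Suc t)
  then obtain t' where t': "\<And>x. topplings s t x \<le> topplings s' t' x" by blast
  show ?case
  proof (cases "s t")
    case None
    then show ?thesis using t' by (auto simp: topplings_Suc)
  next
    case (Some z)
    show ?thesis
    proof (cases "topplings s t z < topplings s' t' z")
      case True
      then have "topplings s (Suc t) x \<le> topplings s' t' x" for x
        using t' [of x] Some by (auto simp: topplings_Suc)
      then show ?thesis by blast
    next
      case False
      then have eq: "topplings s' t' z = topplings s t z" using t' [of z] by simp
      have "run \<sigma> s t z \<le> run \<sigma> s' t' z"
        unfolding run_topplings eq by (intro add_left_mono sum_mono) (simp add: t')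
      moreover have "unstable (run \<sigma> s t) z" using assms(1) Some by (auto simp: legal_def)
      ultimately have "unstable (run \<sigma> s' t') z" by (auto simp: unstable_def)
      then obtain u where u: "u \<ge> t'" "s' u = Some z"
        using assms(2) by (auto simp: stabilizing_def)
      have "topplings s (Suc t) x \<le> topplings s' (Suc u) x" for x
      proof -
        have "topplings s t x \<le> topplings s' u x"
          using t' [of x] topplings_mono [OF u(1), of s' x] by linarith
        then show ?thesis using Some u(2) by (auto simp: topplings_Suc)
      qed
      then show ?thesis by blast
    qed
  qed
qed

lemma legal_range_subset:
  assumes "legal \<sigma> s" "stabilizing \<sigma> s'" "Some x \<in> range s"
  shows "Some x \<in> range s'"
proof -
  obtain t where "s t = Some x" using assms(3) by (metis rangeE)
  then have "0 < topplings s (Suc t) x" by (auto simp: topplings_pos_iff)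
  moreover obtain t' where "topplings s (Suc t) x \<le> topplings s' t' x"
    using legal_topplings_le [OF assms(1,2)] by blast
  ultimately have "0 < topplings s' t' x" by linarith
  then show ?thesis by (metis topplings_pos_iff rangeI)
qed

lemma toppled_sites_eq:
  assumes "stabilizing \<sigma> s"
  shows "toppled_sites \<sigma> = {x. Some x \<in> range s}"
  using assms legal_range_subset unfolding toppled_sites_def stabilizing_def by blast

subsection \<open>Toppling the smallest unstable site\<close>

definition greedy_order :: "(nat \<Rightarrow> int ^ 'd::finite) \<Rightarrow> 'd config \<Rightarrow> (nat \<Rightarrow> (int ^ 'd) option) \<Rightarrow> bool" where
  "greedy_order e \<sigma> s \<longleftrightarrow> (\<forall>t. s t =
     (if \<exists>x. unstable (run \<sigma> s t) x then Some (e (LEAST k. unstable (run \<sigma> s t) (e k))) else None))"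

lemma greedy_order_exists: "\<exists>s. greedy_order e \<sigma> s"
proof -
  define pick where "pick \<eta> = (if \<exists>x. unstable \<eta> x then Some (e (LEAST k. unstable \<eta> (e k))) else None)" for \<eta>
  define step where "step \<eta> = (case pick \<eta> of None \<Rightarrow> \<eta> | Some x \<Rightarrow> topple x \<eta>)" for \<eta>
  define s where "s t = pick ((step ^^ t) \<sigma>)" for t
  have "run \<sigma> s t = (step ^^ t) \<sigma>" for t
  proof (induction t)
    case 0
    then show ?case by simp
  next
    case (Suc t)
    have "s t = pick (run \<sigma> s t)" unfolding Suc by (rule s_def)
    then have "run \<sigma> s (Suc t) = step (run \<sigma> s t)" by (simp add: step_def)
    with Suc show ?case by simp
  qed
  then have "greedy_order e \<sigma> s"
    by (simp add: greedy_order_def s_def pick_def)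
  then show ?thesis by blast
qed

lemma legal_greedy:
  assumes "surj e" "greedy_order e \<sigma> s"
  shows "legal \<sigma> s"
  unfolding legal_def
proof (intro allI impI)
  fix t x assume st: "s t = Some x"
  have *: "s t = (if \<exists>x. unstable (run \<sigma> s t) x
      then Some (e (LEAST k. unstable (run \<sigma> s t) (e k))) else None)"
    using assms(2) unfolding greedy_order_def by blast
  with st have "\<exists>y. unstable (run \<sigma> s t) y" by (auto split: if_splits)
  then obtain y where y: "unstable (run \<sigma> s t) y" ..
  obtain k where "y = e k" using assms(1) by (metis surjD)
  with y have "unstable (run \<sigma> s t) (e (LEAST k. unstable (run \<sigma> s t) (e k)))"
    by (metis (mono_tags, lifting) LeastI)
  moreover have "s t = Some (e (LEAST k. unstable (run \<sigma> s t) (e k)))" using * y by metis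
  ultimately show "unstable (run \<sigma> s t) x" using st by (metis option.inject)
qed

text \<open>
  Legal topplings cannot stay in a finite set forever: let \<open>I\<close> be the sites that topple infinitely
  often. An extreme site \<open>z\<close> of \<open>I\<close> has a neighbour outside \<open>I\<close>, so each of its topplings loses a
  particle from \<open>I\<close>, while legality keeps the number of particles on \<open>I\<close> bounded below.
\<close>

lemma legal_not_confined:
  fixes \<sigma> :: "'d::finite config"
  assumes "legal \<sigma> s" "finite F"
  shows "\<not> (\<forall>t\<ge>t0. \<exists>x\<in>F. s t = Some x)"
proof
  assume conf: "\<forall>t\<ge>t0. \<exists>x\<in>F. s t = Some x"
  define I where "I = {x\<in>F. \<exists>\<^sub>\<infinity>t. s t = Some x}"
  have finI: "finite I" using assms(2) by (simp add: I_def)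
  have "\<forall>\<^sub>\<infinity>t. \<forall>x\<in>F - I. s t \<noteq> Some x"
    using assms(2) by (subst eventually_ball_finite_distrib)
       (auto simp: I_def INFM_nat MOST_nat not_less simp flip: not_frequently)
  then obtain t1 where t1: "\<And>t x. t \<ge> t1 \<Longrightarrow> x \<in> F - I \<Longrightarrow> s t \<noteq> Some x"
    unfolding MOST_nat_le by blast
  define T where "T = max t0 t1"
  have inI: "\<exists>x\<in>I. s t = Some x" if "t \<ge> T" for t
    using conf t1 that by (force simp: T_def)
  then have "I \<noteq> {}" by blast
  define i :: 'd where "i = undefined"
  have "Max ((\<lambda>x. x $ i) ` I) \<in> (\<lambda>x. x $ i) ` I"
    using finI \<open>I \<noteq> {}\<close> by (intro Max_in) auto
  then obtain z where zI: "z \<in> I" and zM: "z $ i = Max ((\<lambda>x. x $ i) ` I)" by auto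
  have z: "z \<in> I" "\<And>x. x \<in> I \<Longrightarrow> x $ i \<le> z $ i"
    using zI finI by (auto simp: zM)
  have out: "z + axis i 1 \<notin> I" using z(2) [of "z + axis i 1"] by auto
  have loss: "card (nbrs x \<inter> I) \<le> 2 * CARD('d)" for x
    by (rule order_trans [OF card_mono card_nbrs_le]) auto
  have "nbrs z \<inter> I \<subset> nbrs z" using out by (auto simp: nbrs_def)
  then have loss_z: "card (nbrs z \<inter> I) < 2 * CARD('d)"
    by (intro less_le_trans [OF psubset_card_mono card_nbrs_le]) auto
  define S where "S t = (\<Sum>y\<in>I. run \<sigma> s t y)" for t
  have S_step: "S (Suc t) = S t - 2 * int CARD('d) + int (card (nbrs x \<inter> I))"
    if "s t = Some x" "x \<in> I" for t x
  proof -
    have "S (Suc t) = S t - (\<Sum>y\<in>I. if y = x then 2 * int CARD('d) else 0)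
            + (\<Sum>y\<in>I. if y \<in> nbrs x then 1 else 0)"
      unfolding S_def using that by (simp add: topple_def sum.distrib sum_subtractf)
    moreover have "(\<Sum>y\<in>I. if y \<in> nbrs x then 1 else 0) = int (card (nbrs x \<inter> I))"
      using finI by (simp add: sum.If_cases Int_commute)
    ultimately show ?thesis using finI that by simp
  qed
  have bound: "S (T + k) + int (card {u. T \<le> u \<and> u < T + k \<and> s u = Some z}) \<le> S T" for k
  proof (induction k)
    case 0
    have "{u. T \<le> u \<and> u < T \<and> s u = Some z} = {}" by auto
    then show ?case by simp
  next
    case (Suc k)
    obtain x where x: "x \<in> I" "s (T + k) = Some x" using inI [of "T + k"] by auto
    have st: "S (T + Suc k) = S (T + k) - 2 * int CARD('d) + int (card (nbrs x \<inter> I))"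
      using S_step [OF x(2,1)] by simp
    have set: "{u. T \<le> u \<and> u < T + Suc k \<and> s u = Some z} =
       (if x = z then insert (T + k) {u. T \<le> u \<and> u < T + k \<and> s u = Some z}
        else {u. T \<le> u \<and> u < T + k \<and> s u = Some z})"
      using x(2) by (auto simp: less_Suc_eq)
    have fin: "finite {u. T \<le> u \<and> u < T + k \<and> s u = Some z}" by simp
    show ?case
    proof (cases "x = z")
      case True
      then show ?thesis using Suc st loss_z fin unfolding set by auto
    next
      case False
      then show ?thesis using Suc st loss [of x] unfolding set by auto
    qed
  qed
  have low: "min (run \<sigma> s T y) 0 \<le> run \<sigma> s (T + k) y" for k y
  proof (induction k)
    case 0
    then show ?case by simp
  next
    case (Suc k)
    obtain x where x: "s (T + k) = Some x" using inI [of "T + k"] by auto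
    then have "unstable (run \<sigma> s (T + k)) x" using assms(1) by (auto simp: legal_def)
    then show ?case using Suc x by (auto simp: topple_def unstable_def)
  qed
  define m where "m = (\<Sum>y\<in>I. min (run \<sigma> s T y) 0)"
  have "m \<le> S (T + k)" for k unfolding m_def S_def by (intro sum_mono low)
  then have cnt: "int (card {u. T \<le> u \<and> u < T + k \<and> s u = Some z}) \<le> S T - m" for k
    using bound [of k] by (smt (verit))
  have inf: "infinite {u. T \<le> u \<and> s u = Some z}"
  proof
    assume "finite {u. T \<le> u \<and> s u = Some z}"
    then have "finite ({u. T \<le> u \<and> s u = Some z} \<union> {..<T})" by simp
    then have "finite {u. s u = Some z}" by (rule rev_finite_subset) auto
    then show False using z(1) by (simp add: I_def frequently_cofinite)
  qed
  then obtain A where A: "A \<subseteq> {u. T \<le> u \<and> s u = Some z}" "finite A" "card A = Suc (nat (S T - m))"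
    by (meson infinite_arbitrarily_large)
  define k where "k = Suc (Max A)"
  have "A \<subseteq> {u. T \<le> u \<and> u < T + k \<and> s u = Some z}"
  proof
    fix u assume "u \<in> A"
    then have "u \<le> Max A" using A(2) by simp
    then show "u \<in> {u. T \<le> u \<and> u < T + k \<and> s u = Some z}"
      using A(1) \<open>u \<in> A\<close> by (auto simp: k_def)
  qed
  then have "card A \<le> card {u. T \<le> u \<and> u < T + k \<and> s u = Some z}"
    by (intro card_mono) auto
  then show False using cnt [of k] A(3) by linarith
qed

lemma stabilizing_greedy:
  assumes "bij e" "greedy_order e \<sigma> s"
  shows "stabilizing \<sigma> s"
proof -
  have surj: "surj e" using assms(1) by (rule bij_is_surj)
  have leg: "legal \<sigma> s" using surj assms(2) by (rule legal_greedy)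
  have "\<exists>t'\<ge>t. s t' = Some x" if un: "unstable (run \<sigma> s t) x" for t x
  proof (rule ccontr)
    assume "\<not> (\<exists>t'\<ge>t. s t' = Some x)"
    then have never: "\<And>t'. t' \<ge> t \<Longrightarrow> s t' \<noteq> Some x" by blast
    have stay: "unstable (run \<sigma> s t') x" if "t' \<ge> t" for t'
      using that
    proof (induction t' rule: dec_induct)
      case base
      then show ?case by (rule un)
    next
      case (step u)
      then show ?case using never [of u]
        by (auto simp: unstable_def topple_def split: option.split)
    qed
    obtain k where k: "x = e k" using surj by (metis surjD)
    have "\<exists>y\<in>e ` {..k}. s t' = Some y" if "t' \<ge> t" for t'
    proof -
      have "s t' = Some (e (LEAST k. unstable (run \<sigma> s t') (e k)))"
        using assms(2) stay [OF that] unfolding greedy_order_def by metis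
      moreover have "(LEAST k. unstable (run \<sigma> s t') (e k)) \<le> k"
        using stay [OF that] k by (intro Least_le) simp
      ultimately show ?thesis by blast
    qed
    then show False using legal_not_confined [OF leg, of "e ` {..k}" t] by blast
  qed
  with leg show ?thesis by (auto simp: stabilizing_def)
qed

end

theory Submission
  imports Defs
begin

text \<open>
  By the least action principle, the odometer is at most every \<open>w \<ge> 0\<close>, of possibly infinite support,
  that makes the configuration stable; so it suffices to find, for every coordinate \<open>i\<close>, such a \<open>w\<close>
  supported in the slab \<open>\<bar>x $ i\<bar> \<le> r\<close>. Let \<open>R = (n / \<omega>_d)^(1/d)\<close>. For the background \<open>d - 1\<close> the odometer \<open>u\<close>
  is supported in a ball of radius about \<open>R\<close>: the burning inequality gives density at least \<open>d\<close> on
  average, so that a local average of \<open>u\<close> has Laplacian at least about \<open>1\<close> away from the source, and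
  it is compared with the solution of the corresponding obstacle problem. Adding to \<open>u\<close> a function
  of \<open>x $ i\<close> with second difference \<open>-(h - d + 1)\<close> for \<open>\<bar>x $ i\<bar> \<le> R\<close> and \<open>2d - 1 - h\<close> beyond raises the
  background to \<open>h\<close>; this function can vanish from \<open>\<bar>x $ i\<bar> = d R / (2d - 1 - h)\<close> on.
\<close>

subsection \<open>The discrete Laplacian\<close>

text \<open>Burning controls final densities only after summation over a finite set and up to its
  boundary, so no pointwise lower bound on the Laplacian of \<open>u\<close> is available; this
  forces the average over a ball \<open>A\<close>, at the price of a small loss of density. The
  point source is the second obstacle. Instead of the lattice Green's function, whose asymptotics
  would be needed, an explicit function of the squared norm is used: its negative Laplacian is a
  positive kernel \<kappa> of total mass at least d \<omega>_d, and the source of \<open>u\<close>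
  is spread by the same kernel. Both averages have a range independent of \<open>n\<close>, and the
  losses of density and mass are paid for by enlarging the radius by a factor slightly above 1. The
  comparison bounds \<open>u\<close> outside a ball only by a constant, not by 0; since the
  background \<open>d - 1\<close> leaves room for \<open>d\<close> more particles per site, a
  barrier of quadratic growth brings \<open>u\<close> down to 0 within boundedly many further
  layers.\<close>

definition lap :: "(int ^ 'd::finite \<Rightarrow> 'a::comm_ring_1) \<Rightarrow> int ^ 'd \<Rightarrow> 'a" where
  "lap f x = (\<Sum>i\<in>UNIV. f (x + axis i 1) + f (x - axis i 1) - 2 * f x)"

lemma sum_nbrs:
  fixes x :: "int ^ 'd::finite"
  shows "(\<Sum>y\<in>nbrs x. f y) = (\<Sum>i\<in>UNIV. f (x + axis i 1) + f (x - axis i 1))"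
proof -
  have inj: "inj (\<lambda>i. x + axis i 1)" "inj (\<lambda>i. x - axis i 1)"
    by (auto simp: inj_on_def axis_eq_axis)
  have "x + axis i 1 \<noteq> x - axis j 1" for i j
  proof
    assume "x + axis i 1 = x - axis j 1"
    then have "(x + axis i 1) $ i = (x - axis j 1) $ i" by simp
    then show False by (simp add: axis_def split: if_splits)
  qed
  then have "range (\<lambda>i. x + axis i 1) \<inter> range (\<lambda>i. x - axis i 1) = {}" by blast
  then show ?thesis
    unfolding nbrs_def by (simp add: sum.union_disjoint sum.reindex inj sum.distrib)
qed

lemma lap_nbrs:
  "lap f x = (\<Sum>y\<in>nbrs x. f y) - 2 * of_nat CARD('d) * f (x :: int ^ 'd::finite)"
  by (simp add: lap_def sum_nbrs sum_subtractf)

text \<open>The form of the maximum principle used throughout: touching from below at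
  \<open>x\<close> orders the Laplacians there. It keeps minima of stabilizing functions stabilizing
  and, with a constant for \<open>g\<close>, rules out a positive Laplacian at a maximum.\<close>

lemma lap_le:
  fixes f g :: "int ^ 'd::finite \<Rightarrow> 'a::linordered_idom"
  assumes "\<And>y. y \<in> nbrs x \<Longrightarrow> f y \<le> g y" "f x = g x"
  shows "lap f x \<le> lap g x"
  unfolding lap_nbrs using assms by (intro diff_mono sum_mono) auto

lemma lap_add: "lap (\<lambda>x. f x + g x) x = lap f x + lap g x"
  unfolding lap_def sum.distrib [symmetric] by (intro sum.cong) (auto simp: algebra_simps)

lemma lap_diff: "lap (\<lambda>x. f x - g x) x = lap f x - lap g x"
  unfolding lap_def sum_subtractf [symmetric] by (intro sum.cong) (auto simp: algebra_simps)

lemma lap_cmult: "lap (\<lambda>x. c * f x) x = c * lap f x"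
  unfolding lap_def sum_distrib_left by (intro sum.cong) (auto simp: algebra_simps)

lemma lap_const [simp]: "lap (\<lambda>x. c) x = 0"
  by (simp add: lap_def)

lemma lap_sum: "lap (\<lambda>x. \<Sum>a\<in>A. f a x) x = (\<Sum>a\<in>A. lap (f a) x)"
proof -
  have "(\<Sum>a\<in>A. lap (f a) x) = (\<Sum>i\<in>UNIV. \<Sum>a\<in>A. f a (x + axis i 1) + f a (x - axis i 1) - 2 * f a x)"
    unfolding lap_def by (rule sum.swap)
  then show ?thesis
    by (simp add: lap_def sum.distrib sum_subtractf sum_distrib_left)
qed

lemma lap_shift: "lap (\<lambda>x. f (x + a)) x = lap f (x + a)"
  unfolding lap_def by (simp add: algebra_simps)

lemma lap_of_int: "lap (\<lambda>x. of_int (f x)) x = of_int (lap f x)"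
  unfolding lap_def by simp

subsection \<open>Stabilizing functions\<close>

definition stabilizes :: "'d::finite config \<Rightarrow> (int ^ 'd \<Rightarrow> int) \<Rightarrow> bool" where
  "stabilizes \<sigma> w \<longleftrightarrow> (\<forall>x. 0 \<le> w x \<and> \<sigma> x + lap w x \<le> 2 * int CARD('d) - 1)"

text \<open>A site about to exceed \<open>w\<close> has toppled exactly \<open>w x\<close> times
  while its neighbours have toppled at most \<open>w\<close> times, so it holds no more than
  \<sigma> plus the Laplacian of \<open>w\<close> and cannot topple legally.\<close>

lemma least_action:
  assumes "legal \<sigma> s" "stabilizes \<sigma> w"
  shows "int (topplings s t x) \<le> w x"
proof (induction t arbitrary: x)
  case 0
  then show ?case using assms(2) by (simp add: stabilizes_def)
next
  case (Suc t)
  show ?case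
  proof (cases "s t = Some x \<and> int (topplings s t x) = w x")
    case True
    then have "unstable (run \<sigma> s t) x" using assms(1) by (auto simp: legal_def)
    moreover have "run \<sigma> s t x \<le> \<sigma> x + lap w x"
      unfolding run_topplings lap_nbrs using True Suc by (auto intro: sum_mono)
    ultimately show ?thesis using assms(2) unfolding stabilizes_def unstable_def by (smt (verit))
  next
    case False
    then show ?thesis using Suc [of x] by (auto simp: topplings_Suc)
  qed
qed

lemma toppled_sites_pos:
  assumes "x \<in> toppled_sites \<sigma>" "stabilizes \<sigma> w"
  shows "0 < w x"
proof -
  obtain s t where s: "stabilizing \<sigma> s" "s t = Some x"
    using assms(1) by (force simp: toppled_sites_def)
  then have "0 < topplings s (Suc t) x" by (auto simp: topplings_pos_iff)
  moreover have "int (topplings s (Suc t) x) \<le> w x"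
    using s(1) assms(2) by (intro least_action) (auto simp: stabilizing_def)
  ultimately show ?thesis by linarith
qed

text \<open>Supplies the function that plays the role of the odometer. The pointwise minimum is
  attained because the values are natural numbers, and at each \<open>x\<close> it touches a
  minimizer for \<open>x\<close> from below.\<close>

lemma minimal_stabilizer_exists:
  assumes "stabilizes \<sigma> w0"
  shows "\<exists>u. stabilizes \<sigma> u \<and> (\<forall>w x. stabilizes \<sigma> w \<longrightarrow> u x \<le> w x)"
proof -
  define m where "m x = (LEAST k. \<exists>w. stabilizes \<sigma> w \<and> nat (w x) = k)" for x
  have m: "\<exists>w. stabilizes \<sigma> w \<and> nat (w x) = m x" for x
    unfolding m_def by (rule LeastI_ex) (use assms in blast)
  have le: "int (m x) \<le> w x" if "stabilizes \<sigma> w" for w x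
  proof -
    have "m x \<le> nat (w x)" unfolding m_def by (rule Least_le) (use that in blast)
    moreover have "0 \<le> w x" using that by (simp add: stabilizes_def)
    ultimately show ?thesis by linarith
  qed
  have "\<sigma> x + lap (\<lambda>x. int (m x)) x \<le> 2 * int CARD('a) - 1" for x
  proof -
    obtain w where w: "stabilizes \<sigma> w" "nat (w x) = m x" using m by blast
    then have "int (m x) = w x" by (metis int_nat_eq stabilizes_def)
    then have "lap (\<lambda>x. int (m x)) x \<le> lap w x" using le [OF w(1)] by (intro lap_le)
    then show ?thesis using w(1) unfolding stabilizes_def by (smt (verit))
  qed
  then have "stabilizes \<sigma> (\<lambda>x. int (m x))" by (simp add: stabilizes_def)
  then show ?thesis using le by blast
qed

section \<open>Edge counts and the burning inequality\<close>

definition internal_edges :: "(int ^ 'd::finite) set \<Rightarrow> int" where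
  "internal_edges A = (\<Sum>i\<in>UNIV. int (card {x\<in>A. x + axis i 1 \<in> A}))"

lemma internal_edges_remove:
  fixes A :: "(int ^ 'd::finite) set"
  assumes "finite A" "x \<in> A"
  shows "internal_edges A = internal_edges (A - {x}) + int (card (nbrs x \<inter> A))"
proof -
  have "int (card {y\<in>A. y + axis i 1 \<in> A}) = int (card {y\<in>A - {x}. y + axis i 1 \<in> A - {x}})
      + ((if x + axis i 1 \<in> A then 1 else 0) + (if x - axis i 1 \<in> A then 1 else 0))" for i
  proof -
    define S where "S = {y\<in>A - {x}. y + axis i 1 \<in> A - {x}}"
    define P where "P = (if x + axis i 1 \<in> A then {x} else {})"
    define Q where "Q = (if x - axis i 1 \<in> A then {x - axis i 1} else {})"
    have ne: "(axis i 1 :: int ^ 'd) \<noteq> 0" by (simp add: axis_eq_0_iff)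
    have "{y\<in>A. y + axis i 1 \<in> A} = S \<union> (P \<union> Q)"
      using assms(2) by (auto simp: S_def P_def Q_def algebra_simps split: if_splits)
    moreover have "S \<inter> (P \<union> Q) = {}" "P \<inter> Q = {}"
      using ne by (auto simp: S_def P_def Q_def)
    moreover have "finite S" "finite P" "finite Q" using assms(1) by (auto simp: S_def P_def Q_def)
    ultimately have "card {y\<in>A. y + axis i 1 \<in> A} = card S + (card P + card Q)"
      by (simp add: card_Un_disjoint)
    then show ?thesis by (simp add: S_def P_def Q_def)
  qed
  moreover have "int (card (nbrs x \<inter> A)) = (\<Sum>y\<in>nbrs x. if y \<in> A then 1 else 0)"
    by (simp add: sum.If_cases)
  ultimately show ?thesis
    unfolding internal_edges_def by (simp add: sum_nbrs sum.distrib)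
qed

text \<open>
  Dhar's burning argument: if every site of \<open>A\<close> kept fewer particles than it has neighbours in \<open>A\<close>,
  then one toppling per site of \<open>A\<close> could be saved, contradicting minimality.
\<close>

lemma internal_edges_le:
  fixes u :: "int ^ 'd::finite \<Rightarrow> int"
  assumes "stabilizes \<sigma> u" and min: "\<And>w x. stabilizes \<sigma> w \<Longrightarrow> u x \<le> w x"
    and "finite A" "\<And>x. x \<in> A \<Longrightarrow> 0 < u x"
  shows "internal_edges A \<le> (\<Sum>x\<in>A. \<sigma> x + lap u x)"
  using assms(3,4)
proof (induction A rule: finite_remove_induct)
  case empty
  then show ?case by (simp add: internal_edges_def)
next
  case (remove A)
  define w where "w x = u x - (if x \<in> A then 1 else 0)" for x
  obtain a where "a \<in> A" using remove by blast
  then have "w a < u a" by (simp add: w_def)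
  then have "\<not> stabilizes \<sigma> w" using min by (meson not_le)
  moreover have "0 \<le> w x" for x
    using assms(1) remove.prems [of x] by (auto simp: w_def stabilizes_def)
  ultimately obtain x where x: "\<sigma> x + lap w x \<ge> 2 * int CARD('d)"
    unfolding stabilizes_def by (metis linorder_not_le zle_diff1_eq)
  have "lap w x = lap u x - lap (\<lambda>x. if x \<in> A then 1 else 0) x"
    unfolding w_def by (rule lap_diff)
  also have "lap (\<lambda>x. if x \<in> A then 1 else 0) x =
      int (card (nbrs x \<inter> A)) - 2 * int CARD('d) * (if x \<in> A then 1 else 0)"
    unfolding lap_nbrs by (simp add: sum.If_cases)
  finally have lw: "lap w x = lap u x - int (card (nbrs x \<inter> A))
      + 2 * int CARD('d) * (if x \<in> A then 1 else 0)" by simp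
  have st: "\<sigma> x + lap u x \<le> 2 * int CARD('d) - 1" using assms(1) by (auto simp: stabilizes_def)
  \<comment> \<open>Outside \<open>A\<close> the subtraction only lowers the Laplacian. The site
    found in \<open>A\<close> keeps at least as many particles as it has neighbours in
    \<open>A\<close>; it burns first, and the induction goes on with the rest.\<close>
  have "x \<in> A" using lw x st by (auto split: if_splits)
  then have ge: "\<sigma> x + lap u x \<ge> int (card (nbrs x \<inter> A))" using lw x by simp
  have "internal_edges (A - {x}) \<le> (\<Sum>x\<in>A - {x}. \<sigma> x + lap u x)"
    using remove.IH [OF \<open>x \<in> A\<close>] remove.prems by auto
  then show ?case
    using ge internal_edges_remove [OF \<open>finite A\<close> \<open>x \<in> A\<close>] sum.remove [OF \<open>finite A\<close> \<open>x \<in> A\<close>]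
    by (smt (verit))
qed

subsection \<open>Functions of one coordinate\<close>

text \<open>An even profile given by its slopes: \<open>E j\<close> is the drop from distance
  \<open>j\<close> to \<open>j + 1\<close>, so second differences are differences of consecutive
  slopes, with a corner at 0.\<close>

definition tail_sum :: "(nat \<Rightarrow> int) \<Rightarrow> nat \<Rightarrow> int \<Rightarrow> int" where
  "tail_sum E J t = (\<Sum>j\<in>{nat \<bar>t\<bar>..<J}. E j)"

lemma lap_coordinate:
  "lap (\<lambda>x. f (x $ i)) x = f (x $ i + 1) + f (x $ i - 1) - 2 * f (x $ i)"
proof -
  have "lap (\<lambda>x. f (x $ i)) x =
      (\<Sum>j\<in>UNIV. if j = i then f (x $ i + 1) + f (x $ i - 1) - 2 * f (x $ i) else 0)"
    unfolding lap_def by (intro sum.cong) (auto simp: axis_def)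
  then show ?thesis by simp
qed

lemma tail_sum_step:
  assumes "\<And>j. j \<ge> J \<Longrightarrow> E j = 0"
  shows "tail_sum E J (int j) = E j + tail_sum E J (int j + 1)"
proof (cases "j < J")
  case True
  then have "{j..<J} = insert j {Suc j..<J}" by auto
  moreover have "nat (int j + 1) = Suc j" by simp
  ultimately show ?thesis by (simp add: tail_sum_def)
qed (use assms in \<open>simp add: tail_sum_def\<close>)

lemma tail_sum_uminus [simp]: "tail_sum E J (- t) = tail_sum E J t"
  by (simp add: tail_sum_def)

lemma tail_sum_nonneg: "(\<And>j. 0 \<le> E j) \<Longrightarrow> 0 \<le> tail_sum E J t"
  by (simp add: tail_sum_def sum_nonneg)

lemma tail_sum_eq_0: "int J \<le> \<bar>t\<bar> \<Longrightarrow> tail_sum E J t = 0"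
  by (simp add: tail_sum_def)

lemma tail_sum_second_difference:
  assumes "\<And>j. j \<ge> J \<Longrightarrow> E j = 0"
  shows "tail_sum E J (t + 1) + tail_sum E J (t - 1) - 2 * tail_sum E J t =
    (if t = 0 then - 2 * E 0 else E (nat \<bar>t\<bar> - 1) - E (nat \<bar>t\<bar>))"
proof -
  have pos: "tail_sum E J (t + 1) + tail_sum E J (t - 1) - 2 * tail_sum E J t =
      E (nat t - 1) - E (nat t)" if "t > 0" for t
  proof -
    define j where "j = nat t - 1"
    have t: "t = int j + 1" using that by (simp add: j_def)
    show ?thesis
      using tail_sum_step [of J E j, OF assms] tail_sum_step [of J E "Suc j", OF assms]
      by (simp add: t algebra_simps nat_add_distrib)
  qed
  consider "t = 0" | "t > 0" | "t < 0" by linarith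
  then show ?thesis
  proof cases
    case 1
    then show ?thesis
      using tail_sum_step [of J E 0, OF assms] tail_sum_uminus [of E J 1] by simp
  next
    case 2
    then show ?thesis using pos [of t] by simp
  next
    case 3
    have "tail_sum E J (- t + 1) = tail_sum E J (t - 1)" "tail_sum E J (- t - 1) = tail_sum E J (t + 1)"
      using tail_sum_uminus [of E J "t - 1"] tail_sum_uminus [of E J "t + 1"] by simp_all
    then show ?thesis using 3 pos [of "- t"] by simp
  qed
qed

section \<open>Barriers depending on one coordinate\<close>

lemma nth_zero_eq_0: "x $ i \<noteq> 0 \<Longrightarrow> x \<noteq> (0 :: int ^ 'd)"
  by auto

lemma nbrs_nth_abs: "y \<in> nbrs (x :: int ^ 'd::finite) \<Longrightarrow> \<bar>x $ i\<bar> \<le> \<bar>y $ i\<bar> + 1"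
  by (auto simp: nbrs_def axis_def split: if_splits)

text \<open>A crude barrier: slopes falling by \<open>d\<close> add at most \<open>d\<close>
  particles to a site, which \<open>d - 1\<close> allows, and the corner at 0 removes 2 d n, more
  than the source. It shows that a minimal stabilizer exists and, used in every coordinate, that its
  support is finite.\<close>

lemma stabilizes_tail_sum:
  fixes i :: "'d::finite"
  shows "stabilizes (const_plus_origin (int CARD('d) - 1) n :: 'd config)
    (\<lambda>x. tail_sum (\<lambda>j. int CARD('d) * int (n - j)) n (x $ i))"
proof -
  define E where "E j = int CARD('d) * int (n - j)" for j
  have "const_plus_origin (int CARD('d) - 1) n x + lap (\<lambda>x. tail_sum E n (x $ i)) x
      \<le> 2 * int CARD('d) - 1" for x :: "int ^ 'd"
  proof -
    have "\<And>j. n \<le> j \<Longrightarrow> E j = 0" by (simp add: E_def)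
    then have lap: "lap (\<lambda>x. tail_sum E n (x $ i)) x =
        (if x $ i = 0 then - 2 * E 0 else E (nat \<bar>x $ i\<bar> - 1) - E (nat \<bar>x $ i\<bar>))"
      unfolding lap_coordinate by (rule tail_sum_second_difference)
    show ?thesis
    proof (cases "x $ i = 0")
      case True
      have "1 * int n \<le> int CARD('d) * int n" by (intro mult_right_mono) (auto simp: Suc_le_eq)
      then show ?thesis
        using True by (simp add: lap const_plus_origin_def E_def)
    next
      case False
      have "E (j - 1) - E j \<le> int CARD('d)" for j
      proof -
        have "int (n - (j - 1)) - int (n - j) \<le> 1" by linarith
        then have "int CARD('d) * (int (n - (j - 1)) - int (n - j)) \<le> int CARD('d) * 1"
          by (intro mult_left_mono) auto
        then show ?thesis by (simp add: E_def algebra_simps)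
      qed
      from this [of "nat \<bar>x $ i\<bar>"] show ?thesis
        using False nth_zero_eq_0 [of x i] by (simp add: lap const_plus_origin_def algebra_simps)
    qed
  qed
  then show ?thesis
    unfolding stabilizes_def E_def [symmetric] by (auto intro!: tail_sum_nonneg simp: E_def)
qed

lemma linear_tail_sum_ge:
  "int J * int J \<le> 2 * tail_sum (\<lambda>j. int c * int (R + J - j)) (R + J) (int R)" if "0 < c"
proof -
  have "(\<Sum>j\<in>{R..<R + J}. int (R + J - j)) = (\<Sum>i\<in>{1..J}. int i)"
    by (rule sum.reindex_bij_witness [of _ "\<lambda>i. R + J - i" "\<lambda>j. R + J - j"]) auto
  moreover have "2 * (\<Sum>i\<in>{1..J}. int i) = int J * (int J + 1)"
    by (induction J) (auto simp: algebra_simps)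
  ultimately have 1: "int J * int J \<le> 2 * (\<Sum>j\<in>{R..<R + J}. int (R + J - j))"
    by (simp add: algebra_simps)
  have "1 * (\<Sum>j\<in>{R..<R + J}. int (R + J - j)) \<le> int c * (\<Sum>j\<in>{R..<R + J}. int (R + J - j))"
    using that by (intro mult_right_mono sum_nonneg) auto
  moreover have "tail_sum (\<lambda>j. int c * int (R + J - j)) (R + J) (int R) =
      int c * (\<Sum>j\<in>{R..<R + J}. int (R + J - j))"
    by (simp only: tail_sum_def sum_distrib_left abs_of_nat nat_int)
  ultimately show ?thesis using 1 by linarith
qed

text \<open>Turns boundedness into vanishing. Beyond distance \<open>R\<close> the function
  \<open>u\<close> is cut down to a barrier that has height at least J^2 / 2 at distance
  \<open>R\<close>, adds at most \<open>d\<close> per site and is 0 from \<open>R + J\<close> on. On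
  the planes at distance \<open>R\<close> the barrier is above \<open>u\<close>, so the cut is
  seamless and the result still stabilizes; minimality concludes.\<close>

lemma minimal_stabilizer_slab:
  fixes u :: "int ^ 'd::finite \<Rightarrow> int" and n :: nat
  defines "\<sigma> \<equiv> const_plus_origin (int CARD('d) - 1) n"
  assumes st: "stabilizes \<sigma> u" and min: "\<And>w x. stabilizes \<sigma> w \<Longrightarrow> u x \<le> w x"
    and bd: "\<And>x. \<bar>x $ i\<bar> = int R \<Longrightarrow> 2 * u x \<le> int J * int J"
    and x: "int (R + J) \<le> \<bar>x $ i\<bar>"
  shows "u x = 0"
proof -
  define E where "E j = int CARD('d) * int (R + J - j)" for j
  define b where "b = (\<lambda>x :: int ^ 'd. tail_sum E (R + J) (x $ i))"
  define w where "w x = (if \<bar>x $ i\<bar> \<le> int R then u x else min (u x) (b x))" for x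
  have E: "\<And>j. R + J \<le> j \<Longrightarrow> E j = 0" by (simp add: E_def)
  have slope: "E (j - 1) - E j \<le> int CARD('d)" for j
  proof -
    have "int (R + J - (j - 1)) - int (R + J - j) \<le> 1" by linarith
    then have "int CARD('d) * (int (R + J - (j - 1)) - int (R + J - j)) \<le> int CARD('d) * 1"
      by (intro mult_left_mono) auto
    then show ?thesis by (simp add: E_def algebra_simps)
  qed
  have b0: "0 \<le> b x" for x unfolding b_def by (intro tail_sum_nonneg) (simp add: E_def)
  have u0: "0 \<le> u x" for x using st by (auto simp: stabilizes_def)
  have wu: "w x \<le> u x" for x by (simp add: w_def)
  have wb: "w x \<le> b x" if "int R \<le> \<bar>x $ i\<bar>" for x
  proof (cases "\<bar>x $ i\<bar> = int R")
    case True
    have "b x = tail_sum E (R + J) (int R)"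
      unfolding b_def tail_sum_def True by simp
    then have "int J * int J \<le> 2 * b x"
      using linear_tail_sum_ge [of "CARD('d)" J R] by (simp add: E_def [abs_def])
    then show ?thesis using bd [OF True] True by (simp add: w_def)
  qed (use that in \<open>simp add: w_def\<close>)
  have "\<sigma> x + lap w x \<le> 2 * int CARD('d) - 1" for x
  proof (cases "w x = u x")
    case True
    then have "lap w x \<le> lap u x" using wu by (intro lap_le) auto
    then show ?thesis using st unfolding stabilizes_def by (smt (verit))
  next
    case False
    then have x: "\<bar>x $ i\<bar> > int R" "w x = b x" by (auto simp: w_def min_def split: if_splits)
    have "lap w x \<le> lap b x"
    proof (rule lap_le)
      fix y assume "y \<in> nbrs x"
      then show "w y \<le> b y" using nbrs_nth_abs [of y x i] x by (intro wb) linarith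
    qed (use x in simp)
    moreover have "lap b x = E (nat \<bar>x $ i\<bar> - 1) - E (nat \<bar>x $ i\<bar>)"
      unfolding b_def lap_coordinate using tail_sum_second_difference [of "R + J" E, OF E] x by auto
    then have "lap b x \<le> int CARD('d)" using slope by simp
    moreover have "\<sigma> x = int CARD('d) - 1"
      using x nth_zero_eq_0 [of x i] by (simp add: \<sigma>_def const_plus_origin_def)
    ultimately show ?thesis by linarith
  qed
  then have "stabilizes \<sigma> w" using u0 b0 by (auto simp: stabilizes_def w_def)
  then have "u x \<le> w x" by (rule min)
  moreover have "w x \<le> b x" using x by (intro wb) auto
  moreover have "b x = 0" unfolding b_def using x by (intro tail_sum_eq_0) auto
  ultimately show ?thesis using u0 [of x] by linarith
qed

text \<open>
  The background modification: adding to \<open>u\<close> a profile that depends on \<open>x $ i\<close> only removes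
  \<open>k\<close> particles per site from the slab that contains the support of \<open>u\<close>, and puts them outside.
\<close>

lemma stabilizes_raise_background:
  fixes u :: "int ^ 'd::finite \<Rightarrow> int" and k a :: int
  assumes st: "stabilizes (const_plus_origin (int CARD('d) - 1) n) u"
    and u0: "\<And>x. int R \<le> \<bar>x $ i\<bar> \<Longrightarrow> u x = 0"
    and k: "0 \<le> k" and a: "0 \<le> a" "k + a = int CARD('d)"
    and L: "R < L" "k * (int R + 1) \<le> a * (int L - int R)"
  obtains w where "stabilizes (const_plus_origin (int CARD('d) - 1 + k) n) w"
    "\<And>x. int L \<le> \<bar>x $ i\<bar> \<Longrightarrow> w x = 0"
proof -
  \<comment> \<open>The slopes rise by \<open>k\<close> per step up to distance \<open>R\<close>,
    then fall by \<open>a\<close> per step until they are cut off at 0; the condition on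
    \<open>L\<close> says that this has happened by distance \<open>L\<close>.\<close>
  define E where "E j = (if j \<le> R then k * (int j + 1)
    else max 0 (k * (int R + 1) - a * (int j - int R)))" for j
  define v where "v = (\<lambda>x :: int ^ 'd. tail_sum E L (x $ i))"
  have E0: "E j = 0" if "L \<le> j" for j
  proof -
    have "a * (int L - int R) \<le> a * (int j - int R)" using that a by (intro mult_left_mono) auto
    then show ?thesis using that L by (auto simp: E_def)
  qed
  have E_nonneg: "0 \<le> E j" for j using k by (auto simp: E_def)
  have v: "lap v x = (if x $ i = 0 then - 2 * E 0 else E (nat \<bar>x $ i\<bar> - 1) - E (nat \<bar>x $ i\<bar>))" for x
    unfolding v_def lap_coordinate by (rule tail_sum_second_difference [OF E0])
  have in_slab: "lap v x \<le> - k" if "\<bar>x $ i\<bar> \<le> int R" for x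
  proof (cases "x $ i = 0")
    case True
    then show ?thesis using k by (simp add: v E_def)
  next
    case False
    have "nat \<bar>x $ i\<bar> \<le> R" "nat \<bar>x $ i\<bar> - 1 \<le> R" using that by linarith+
    then show ?thesis using False by (simp add: v E_def of_nat_diff algebra_simps)
  qed
  have out_slab: "lap v x \<le> a" if "int R < \<bar>x $ i\<bar>" for x
  proof -
    define j where "j = nat \<bar>x $ i\<bar>"
    have j: "R < j" "x $ i \<noteq> 0" using that by (auto simp: j_def)
    consider "j = Suc R" | "Suc R < j" using j by linarith
    then have "E (j - 1) - E j \<le> a"
    proof cases
      case 1
      then show ?thesis by (simp add: E_def)
    next
      case 2
      have "a * (int j - 1 - int R) = a * (int j - int R) - a" by (simp add: algebra_simps)
      moreover have "\<not> j \<le> R" "\<not> j - 1 \<le> R" "int (j - 1) = int j - 1" using 2 by linarith+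
      ultimately show ?thesis using a unfolding E_def by auto
    qed
    then show ?thesis using j by (simp add: v j_def)
  qed
  have "const_plus_origin (int CARD('d) - 1 + k) n x + lap (\<lambda>x. u x + v x) x \<le> 2 * int CARD('d) - 1" for x
  proof (cases "\<bar>x $ i\<bar> \<le> int R")
    case True
    have "const_plus_origin (int CARD('d) - 1) n x + lap u x \<le> 2 * int CARD('d) - 1"
      using st by (auto simp: stabilizes_def)
    then show ?thesis using in_slab [OF True] by (simp add: const_plus_origin_def lap_add)
  next
    case False
    have "u y = 0" if "y \<in> nbrs x" for y
      using nbrs_nth_abs [OF that, of i] False by (intro u0) linarith
    moreover have "u x = 0" using False by (intro u0) linarith
    ultimately have "lap u x = 0" by (simp add: lap_nbrs)
    moreover have "x \<noteq> 0" using False by auto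
    ultimately show ?thesis
      using out_slab [of x] False a by (simp add: const_plus_origin_def lap_add)
  qed
  moreover have "0 \<le> u x + v x" for x
    using st tail_sum_nonneg [of E L, OF E_nonneg] by (auto simp: stabilizes_def v_def)
  ultimately have "stabilizes (const_plus_origin (int CARD('d) - 1 + k) n) (\<lambda>x. u x + v x)"
    by (auto simp: stabilizes_def)
  moreover have "u x + v x = 0" if "int L \<le> \<bar>x $ i\<bar>" for x
    using u0 [of x] tail_sum_eq_0 [OF that] that L by (simp add: v_def)
  ultimately show thesis using that by blast
qed

subsection \<open>Lattice vectors in Euclidean space\<close>

definition rvec :: "int ^ 'd::finite \<Rightarrow> real ^ 'd" where
  "rvec x = (\<chi> i. real_of_int (x $ i))"

definition lball :: "real \<Rightarrow> (int ^ 'd::finite) set" where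
  "lball r = {x. norm (rvec x) \<le> r}"

lemma rvec_nth [simp]: "rvec x $ i = real_of_int (x $ i)"
  by (simp add: rvec_def)

lemma rvec_add: "rvec (x + y) = rvec x + rvec y"
  and rvec_diff: "rvec (x - y) = rvec x - rvec y"
  and rvec_uminus [simp]: "rvec (- x) = - rvec x"
  and rvec_0 [simp]: "rvec 0 = 0"
  by (simp_all add: vec_eq_iff)

lemma rvec_axis [simp]: "rvec (axis i 1) = axis i 1"
  by (simp add: vec_eq_iff axis_def)

lemma norm_rvec_sq: "(norm (rvec x))\<^sup>2 = (\<Sum>i\<in>UNIV. (real_of_int (x $ i))\<^sup>2)"
  by (simp add: norm_vec_def L2_set_def sum_nonneg)

lemma norm_rvec_add_axis:
  "(norm (rvec (x + axis i 1)))\<^sup>2 = (norm (rvec x))\<^sup>2 + (1 + 2 * real_of_int (x $ i))"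
  "(norm (rvec (x - axis i 1)))\<^sup>2 = (norm (rvec x))\<^sup>2 + (1 - 2 * real_of_int (x $ i))"
  by (simp_all add: rvec_add rvec_diff power2_norm_eq_inner inner_add_left inner_add_right
      inner_diff_left inner_diff_right inner_axis inner_commute [of "axis i 1"])

lemma norm_rvec_nbrs:
  assumes "y \<in> nbrs x"
  shows "norm (rvec y) \<le> norm (rvec x) + 1"
proof -
  obtain i where "y = x + axis i 1 \<or> y = x - axis i 1" using assms by (auto simp: nbrs_def)
  then have "norm (rvec y) \<le> norm (rvec x) + norm (axis i (1::real))"
    using norm_triangle_ineq [of "rvec x" "axis i 1"] norm_triangle_ineq4 [of "rvec x" "axis i 1"]
    by (auto simp: rvec_add rvec_diff)
  then show ?thesis by simp
qed

lemma finite_lball [simp]: "finite (lball r :: (int ^ 'd::finite) set)"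
proof -
  have "lball r \<subseteq> vec_lambda ` (PiE UNIV (\<lambda>_. {- \<lceil>r\<rceil>..\<lceil>r\<rceil>}) :: ('d \<Rightarrow> int) set)"
  proof
    fix x :: "int ^ 'd" assume x: "x \<in> lball r"
    have "\<bar>real_of_int (x $ i)\<bar> \<le> r" for i
      using component_le_norm_cart [of "rvec x" i] x by (simp add: lball_def)
    then have "\<bar>x $ i\<bar> \<le> \<lceil>r\<rceil>" for i
      by (metis le_of_int_ceiling of_int_abs of_int_le_iff order_trans)
    then have "vec_nth x \<in> PiE UNIV (\<lambda>_. {- \<lceil>r\<rceil>..\<lceil>r\<rceil>})" by (auto simp: abs_le_iff minus_le_iff)
    then show "x \<in> vec_lambda ` (PiE UNIV (\<lambda>_. {- \<lceil>r\<rceil>..\<lceil>r\<rceil>}))"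
      by (metis image_eqI vec_nth_inverse)
  qed
  then show ?thesis by (rule finite_subset) (intro finite_imageI finite_PiE, auto)
qed

lemma zero_in_lball [simp]: "0 \<in> lball r \<longleftrightarrow> 0 \<le> r"
  by (simp add: lball_def)

lemma uminus_in_lball [simp]: "- x \<in> lball r \<longleftrightarrow> x \<in> lball r"
  by (simp add: lball_def)

lemma lball_mono: "r \<le> r' \<Longrightarrow> lball r \<subseteq> lball r'"
  by (auto simp: lball_def)

subsection \<open>Counting lattice points\<close>

lemma measure_unit_cell:
  "measure lborel (cbox a (a + 1 :: real ^ 'd::finite)) = 1"
  "measure lborel (box a (a + 1 :: real ^ 'd::finite)) = 1"
proof -
  have ab: "a \<bullet> b \<le> (a + 1) \<bullet> b" and one: "(a + 1 - a) \<bullet> b = 1" if "b \<in> Basis" for b :: "real ^ 'd"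
    using that by (auto simp: Basis_vec_def inner_axis)
  show "measure lborel (cbox a (a + 1)) = 1" using ab one by (simp add: measure_lborel_cbox_eq)
  show "measure lborel (box a (a + 1)) = 1" using ab one by (simp add: measure_lborel_box_eq)
qed

lemma norm_unit_cell:
  assumes "y \<in> cbox (rvec x) (rvec x + 1)"
  shows "norm (y - rvec x :: real ^ 'd::finite) \<le> real CARD('d)"
proof -
  have "norm (y - rvec x) \<le> (\<Sum>i\<in>UNIV. \<bar>(y - rvec x) $ i\<bar>)" by (rule norm_le_l1_cart)
  also have "\<dots> \<le> (\<Sum>i\<in>(UNIV :: 'd set). 1)"
    using assms by (intro sum_mono) (auto simp: mem_box_cart abs_le_iff algebra_simps)
  finally show ?thesis by simp
qed

text \<open>Disjoint open unit cells at the lattice points pack into a slightly larger ball. Cells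
  have diameter at most \<open>d\<close>; the second \<open>d\<close> only makes the inclusion in an
  open ball strict. The lower bound below covers a smaller ball by closed cells.\<close>

lemma card_lball_le:
  assumes "0 \<le> r"
  shows "real (card (lball r :: (int ^ 'd::finite) set))
    \<le> unit_ball_vol (real CARD('d)) * (r + 2 * real CARD('d)) ^ CARD('d)"
proof -
  define cell where "cell x = box (rvec x) (rvec x + 1)" for x :: "int ^ 'd"
  let ?B = "ball (0 :: real ^ 'd) (r + 2 * real CARD('d))"
  have disj: "disjoint_family_on cell (lball r)"
    unfolding disjoint_family_on_def
  proof (intro ballI impI)
    fix x y :: "int ^ 'd" assume "x \<noteq> y"
    then obtain i where i: "x $ i \<noteq> y $ i" by (auto simp: vec_eq_iff)
    show "cell x \<inter> cell y = {}"
    proof (rule ccontr)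
      assume "cell x \<inter> cell y \<noteq> {}"
      then obtain z where "z \<in> cell x" "z \<in> cell y" by blast
      then have "real_of_int (x $ i) < real_of_int (y $ i) + 1" "real_of_int (y $ i) < real_of_int (x $ i) + 1"
        unfolding cell_def mem_box_cart by (force dest: spec [of _ i])+
      then show False using i by linarith
    qed
  qed
  have sub: "(\<Union>x\<in>lball r. cell x) \<subseteq> ?B"
  proof (rule UN_least, rule subsetI)
    fix x y assume x: "x \<in> lball r" and "y \<in> cell x"
    then have "y \<in> cbox (rvec x) (rvec x + 1)" unfolding cell_def using box_subset_cbox by blast
    then have "norm (y - rvec x) \<le> real CARD('d)" by (rule norm_unit_cell)
    moreover have "norm y \<le> norm (y - rvec x) + norm (rvec x)" by (metis diff_add_cancel norm_triangle_ineq)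
    moreover have "0 < real CARD('d)" by simp
    moreover have "norm (rvec x) \<le> r" using x by (simp add: lball_def)
    ultimately have "norm y < r + 2 * real CARD('d)" by linarith
    then show "y \<in> ?B" by simp
  qed
  have "real (card (lball r :: (int ^ 'd) set)) = (\<Sum>x\<in>(lball r :: (int ^ 'd) set). measure lborel (cell x))"
    by (simp add: cell_def measure_unit_cell)
  also have "\<dots> = measure lborel (\<Union>x\<in>lball r. cell x)"
    by (rule measure_finite_Union [symmetric]) (use disj in \<open>auto simp: cell_def [abs_def] emeasure_lborel_box_eq\<close>)
  also have "\<dots> \<le> measure lborel ?B"
    by (rule measure_mono_fmeasurable [OF sub]) (auto simp: cell_def intro!: fmeasurableI emeasure_lborel_ball_finite)
  also have "\<dots> = unit_ball_vol (real CARD('d)) * (r + 2 * real CARD('d)) ^ CARD('d)"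
    using assms by (subst content_ball) auto
  finally show ?thesis .
qed

lemma card_lball_ge:
  assumes "real CARD('d::finite) \<le> r"
  shows "unit_ball_vol (real CARD('d)) * (r - real CARD('d)) ^ CARD('d)
    \<le> real (card (lball r :: (int ^ 'd) set))"
proof -
  define cell where "cell x = cbox (rvec x) (rvec x + 1)" for x :: "int ^ 'd"
  let ?B = "ball (0 :: real ^ 'd) (r - real CARD('d))"
  have sub: "?B \<subseteq> (\<Union>x\<in>lball r. cell x)"
  proof
    fix y assume y: "y \<in> ?B"
    define x :: "int ^ 'd" where "x = (\<chi> i. \<lfloor>y $ i\<rfloor>)"
    have cell: "y \<in> cell x"
      unfolding cell_def mem_box_cart x_def by (auto intro: less_imp_le)
    then have "norm (y - rvec x) \<le> real CARD('d)" unfolding cell_def by (rule norm_unit_cell)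
    moreover have "norm (rvec x) \<le> norm y + norm (y - rvec x)"
      by (metis add.commute norm_minus_commute norm_triangle_sub)
    ultimately have "x \<in> lball r" using y by (simp add: lball_def)
    then show "y \<in> (\<Union>x\<in>lball r. cell x)" using cell by blast
  qed
  have "unit_ball_vol (real CARD('d)) * (r - real CARD('d)) ^ CARD('d) = measure lborel ?B"
    using assms by (subst content_ball) auto
  also have "\<dots> \<le> measure lborel (\<Union>x\<in>lball r. cell x)"
    by (rule measure_mono_fmeasurable [OF sub]) (auto simp: cell_def intro!: fmeasurable.finite_UN)
  also have "\<dots> \<le> (\<Sum>x\<in>(lball r :: (int ^ 'd) set). measure lborel (cell x))"
    by (rule measure_UNION_le) (auto simp: cell_def)
  also have "\<dots> = real (card (lball r :: (int ^ 'd) set))"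
    by (simp add: cell_def measure_unit_cell)
  finally show ?thesis .
qed

lemma card_lball_asymp:
  "((\<lambda>r. real (card (lball r :: (int ^ 'd::finite) set)) / r ^ CARD('d))
    \<longlongrightarrow> unit_ball_vol (real CARD('d))) at_top"
proof (rule tendsto_sandwich)
  let ?v = "unit_ball_vol (real CARD('d))" and ?d = "real CARD('d)"
  have "((\<lambda>r. c / r) \<longlongrightarrow> 0) at_top" for c :: real
    by (rule real_tendsto_divide_at_top [OF tendsto_const filterlim_ident])
  then have lim: "((\<lambda>r. ?v * (1 + c / r) ^ CARD('d)) \<longlongrightarrow> ?v * (1 + 0) ^ CARD('d)) at_top" for c :: real
    by (intro tendsto_intros)
  from lim [of "- ?d"] show "((\<lambda>r. ?v * (1 - ?d / r) ^ CARD('d)) \<longlongrightarrow> ?v) at_top" by simp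
  from lim [of "2 * ?d"] show "((\<lambda>r. ?v * (1 + 2 * ?d / r) ^ CARD('d)) \<longlongrightarrow> ?v) at_top" by simp
  have rew: "(1 + c / r) ^ CARD('d) = (r + c) ^ CARD('d) / r ^ CARD('d)" if "r > 0" for c r :: real
    using that by (simp add: power_divide [symmetric] add_divide_distrib)
  show "\<forall>\<^sub>F r in at_top. ?v * (1 - ?d / r) ^ CARD('d)
      \<le> real (card (lball r :: (int ^ 'd) set)) / r ^ CARD('d)"
    using eventually_ge_at_top [of ?d] eventually_gt_at_top [of 0]
  proof eventually_elim
    case (elim r)
    then show ?case
      using card_lball_ge [where 'd = 'd, of r] rew [of r "- ?d"] by (simp add: divide_right_mono)
  qed
  show "\<forall>\<^sub>F r in at_top. real (card (lball r :: (int ^ 'd) set)) / r ^ CARD('d)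
      \<le> ?v * (1 + 2 * ?d / r) ^ CARD('d)"
    using eventually_gt_at_top [of 0]
  proof eventually_elim
    case (elim r)
    then show ?case
      using card_lball_le [where 'd = 'd, of r] rew [of r "2 * ?d"] by (simp add: divide_right_mono)
  qed
qed

text \<open>Together with the unshifted limit this makes the shell between radii
  \<open>r - 1\<close> and \<open>r\<close> negligible against \<open>r ^ d\<close>, which absorbs
  the boundary terms of lattice balls.\<close>

lemma card_lball_asymp_shift:
  "((\<lambda>r. real (card (lball (r - 1) :: (int ^ 'd::finite) set)) / r ^ CARD('d))
    \<longlongrightarrow> unit_ball_vol (real CARD('d))) at_top"
proof -
  let ?N = "\<lambda>r. real (card (lball r :: (int ^ 'd) set))"
  have "filterlim (\<lambda>r::real. - 1 + r) at_top at_top"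
    by (rule filterlim_tendsto_add_at_top [OF tendsto_const filterlim_ident])
  then have "((\<lambda>r. ?N (r - 1) / (r - 1) ^ CARD('d)) \<longlongrightarrow> unit_ball_vol (real CARD('d))) at_top"
    using filterlim_compose [OF card_lball_asymp [where 'd = 'd], of "\<lambda>r. r - 1"] by simp
  moreover have "((\<lambda>r::real. 1 / r) \<longlongrightarrow> 0) at_top"
    by (rule real_tendsto_divide_at_top [OF tendsto_const filterlim_ident])
  then have "((\<lambda>r::real. (1 - 1 / r) ^ CARD('d)) \<longlongrightarrow> (1 - 0) ^ CARD('d)) at_top"
    by (intro tendsto_intros)
  ultimately have "((\<lambda>r. ?N (r - 1) / (r - 1) ^ CARD('d) * (1 - 1 / r) ^ CARD('d))
      \<longlongrightarrow> unit_ball_vol (real CARD('d)) * (1 - 0) ^ CARD('d)) at_top"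
    by (rule tendsto_mult)
  moreover have "\<forall>\<^sub>F r in at_top. ?N (r - 1) / (r - 1) ^ CARD('d) * (1 - 1 / r) ^ CARD('d)
      = ?N (r - 1) / r ^ CARD('d)"
    using eventually_gt_at_top [of 1]
  proof eventually_elim
    case (elim r)
    then have "(1 - 1 / r) ^ CARD('d) = (r - 1) ^ CARD('d) / r ^ CARD('d)"
      by (simp add: power_divide [symmetric] diff_divide_distrib)
    then show ?case using elim by simp
  qed
  ultimately show ?thesis by (simp add: filterlim_cong)
qed

subsection \<open>A discretely superharmonic radial potential\<close>

text \<open>For p = d / 2 and \<open>a\<close> the squared norm this is the Newtonian potential up
  to a factor: \<open>\<bar>x\<bar>\<close> to the power 2 - d, minus the logarithm for d = 2, minus
  \<open>\<bar>x\<bar>\<close> for d = 1. The normalization gives the derivative the same form in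
  all dimensions.\<close>

definition pot :: "real \<Rightarrow> real \<Rightarrow> real" where
  "pot p a = (if p = 1 then - ln a / 2 else a powr (1 - p) / (2 * (p - 1)))"

lemma has_derivative_pot:
  assumes "0 < a"
  shows "(pot p has_real_derivative - (1/2) * a powr (- p)) (at a)"
proof (cases "p = 1")
  case True
  then have "pot p = (\<lambda>a. - ln a / 2)" by (auto simp: pot_def)
  moreover have "((\<lambda>a. - ln a / 2) has_real_derivative - (1/2) * a powr (- p)) (at a)"
    using assms True by (auto intro!: derivative_eq_intros simp: powr_minus divide_simps)
  ultimately show ?thesis by simp
next
  case False
  then have "pot p = (\<lambda>a. a powr (1 - p) / (2 * (p - 1)))" by (auto simp: pot_def)
  moreover have "((\<lambda>a. a powr (1 - p) / (2 * (p - 1))) has_real_derivative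
      ((1 - p) * a powr (1 - p - 1)) / (2 * (p - 1))) (at a)"
    using assms by (intro DERIV_cdivide has_real_derivative_powr)
  moreover have "((1 - p) * a powr (1 - p - 1)) / (2 * (p - 1)) = - (1/2) * a powr (- p)"
    using False by (simp add: divide_simps) (simp add: algebra_simps)
  ultimately show ?thesis by simp
qed

text \<open>At lattice steps \<open>e\<close> can be of order sqrt a, so a cubic remainder would be
  of order a^(-p - 1/2), too large against the gain c a^(-p - 1). The cubic term is therefore kept
  explicit, to be summed over opposite neighbours, and only the quartic one is estimated; the bound
  on \<open>e\<close> keeps its intermediate point above a / 2.\<close>

lemma pot_Taylor_le:
  fixes a e p :: real
  assumes "0 < a" "\<bar>e\<bar> \<le> a / 2" "0 \<le> p"
  shows "pot p (a + e) \<le> pot p a - a powr (- p) / 2 * e + p * a powr (- p - 1) / 4 * e\<^sup>2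
    - p * (p + 1) * a powr (- p - 2) / 12 * e ^ 3
    + p * (p + 1) * (p + 2) * 2 powr (p + 3) * a powr (- p - 3) / 48 * e ^ 4"
proof (cases "e = 0")
  case False
  define D :: "nat \<Rightarrow> real \<Rightarrow> real" where "D m t = (if m = 0 then pot p t
    else if m = 1 then - (1/2) * t powr (- p)
    else if m = 2 then p / 2 * t powr (- p - 1)
    else if m = 3 then - (p * (p + 1) / 2) * t powr (- p - 2)
    else p * (p + 1) * (p + 2) / 2 * t powr (- p - 3))" for m t
  have pw: "((\<lambda>t. c * t powr q) has_real_derivative c * (q * t powr (q - 1))) (at t)"
    if "0 < t" for c q t :: real
    using that by (intro DERIV_cmult has_real_derivative_powr)
  have D: "(D m has_real_derivative D (Suc m) t) (at t)" if m: "m < 4" "a / 2 \<le> t" for m t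
  proof -
    have t: "0 < t" using m assms by linarith
    consider "m = 0" | "m = 1" | "m = 2" | "m = 3" using m by linarith
    then show ?thesis
    proof cases
      case 1
      then show ?thesis using has_derivative_pot [OF t] by (simp add: D_def [abs_def])
    next
      case 2
      then show ?thesis using pw [OF t, of "- (1/2)" "- p"] by (simp add: D_def [abs_def])
    next
      case 3
      then have "D m = (\<lambda>t. p / 2 * t powr (- p - 1))"
        "D (Suc m) t = p / 2 * ((- p - 1) * t powr (- p - 1 - 1))"
        by (simp_all add: D_def [abs_def] field_simps)
      then show ?thesis using pw [OF t, of "p / 2" "- p - 1"] by (simp only:)
    next
      case 4
      then have "D m = (\<lambda>t. - (p * (p + 1) / 2) * t powr (- p - 2))"
        "D (Suc m) t = - (p * (p + 1) / 2) * ((- p - 2) * t powr (- p - 2 - 1))"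
        by (simp_all add: D_def [abs_def] field_simps)
      then show ?thesis using pw [OF t, of "- (p * (p + 1) / 2)" "- p - 2"] by (simp only:)
    qed
  qed
  have "\<exists>t. (if a + e < a then a + e < t \<and> t < a else a < t \<and> t < a + e) \<and>
      pot p (a + e) = (\<Sum>m<4. D m a / fact m * (a + e - a) ^ m) + D 4 t / fact 4 * (a + e - a) ^ 4"
    by (rule Taylor [where a = "a / 2" and b = "3 * a / 2"])
       (use D False assms in \<open>auto simp: D_def [of 0] fun_eq_iff abs_le_iff\<close>)
  then obtain t where t: "if e < 0 then a + e < t \<and> t < a else a < t \<and> t < a + e"
    and eq: "pot p (a + e) = (\<Sum>m<4. D m a / fact m * e ^ m) + D 4 t / fact 4 * e ^ 4"
    by auto
  have "a / 2 \<le> t" using t assms by (auto split: if_splits simp: abs_le_iff)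
  then have "t powr (- p - 3) \<le> (a / 2) powr (- p - 3)"
    using assms by (intro powr_mono2') auto
  also have "\<dots> = 2 powr (p + 3) * a powr (- p - 3)"
    using assms by (simp add: powr_divide powr_minus_divide powr_minus field_simps flip: powr_add)
  finally have "D 4 t \<le> p * (p + 1) * (p + 2) / 2 * (2 powr (p + 3) * a powr (- p - 3))"
    using assms unfolding D_def by (simp add: mult_left_mono)
  then have "D 4 t / fact 4 * e ^ 4
      \<le> (p * (p + 1) * (p + 2) / 2 * (2 powr (p + 3) * a powr (- p - 3))) / fact 4 * e ^ 4"
    by (intro mult_right_mono divide_right_mono) auto
  moreover have "(\<Sum>m<4. D m a / fact m * e ^ m) = pot p a - a powr (- p) / 2 * e
      + p * a powr (- p - 1) / 4 * e\<^sup>2 - p * (p + 1) * a powr (- p - 2) / 12 * e ^ 3"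
    by (simp add: D_def eval_nat_numeral fact_numeral)
  ultimately show ?thesis
    unfolding eq by (simp add: fact_numeral eval_nat_numeral)
qed simp

definition radial_pot :: "real \<Rightarrow> int ^ 'd::finite \<Rightarrow> real" where
  "radial_pot c x = pot (real CARD('d) / 2) ((norm (rvec x))\<^sup>2 + c)"

text \<open>
  In the continuum, \<open>pot\<close> of the squared norm plus \<open>c\<close> has a negative Laplacian proportional to \<open>c\<close>, of the
  same order of decay as the fourth-order error of the discretization; hence a large \<open>c\<close> will do.
\<close>

lemma radial_pot_superharmonic:
  "\<exists>c\<ge>1. \<forall>x :: int ^ 'd::finite. lap (radial_pot c) x < 0"
proof -
  define d where "d = real CARD('d)"
  define p where "p = d / 2"
  define K where "K = p * (p + 1) * (p + 2) * 2 powr (p + 3)"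
  \<comment> \<open>The final estimate has the factor c - d / 4 - 4 K, here 6. The summand 6 also
    gives t^2 + 6 \<le> a, which by (t - 2)^2 \<ge> 0 and (t + 2)^2 \<ge> 0 keeps both increments
    within a / 2.\<close>
  define c where "c = d / 4 + 4 * K + 6"
  have d: "0 < d" by (simp add: d_def)
  then have p: "0 < p" and K: "0 < K" by (simp_all add: p_def K_def)
  have c: "6 \<le> c" using d K by (simp add: c_def)
  have "lap (radial_pot c) x < 0" for x :: "int ^ 'd"
  proof -
    define s where "s = (norm (rvec x))\<^sup>2"
    define a where "a = s + c"
    have s: "s = (\<Sum>i\<in>UNIV. (real_of_int (x $ i))\<^sup>2)" unfolding s_def by (rule norm_rvec_sq)
    have "0 \<le> s" by (simp add: s_def)
    then have a: "6 \<le> a" using c by (simp add: a_def)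
    have bound: "pot p (a + (1 + 2 * t)) + pot p (a + (1 - 2 * t)) - 2 * pot p a
        \<le> - (a powr (- p)) + p * a powr (- p - 1) / 2 * (1 + 4 * t\<^sup>2) + 4 * K * a powr (- p - 1)"
      if t: "t\<^sup>2 \<le> s" for t
    proof -
      have ta: "t\<^sup>2 + 6 \<le> a" using t c by (simp add: a_def)
      have small: "\<bar>1 + 2 * t\<bar> \<le> a / 2" "\<bar>1 - 2 * t\<bar> \<le> a / 2"
        using ta zero_le_power2 [of "t - 2"] zero_le_power2 [of "t + 2"]
        unfolding abs_le_iff power2_eq_square ring_distribs by linarith+
      have e4: "(1 + 2 * t) ^ 4 + (1 - 2 * t) ^ 4 = 2 + 48 * t\<^sup>2 + 32 * (t\<^sup>2)\<^sup>2"
        and e3: "(1 + 2 * t) ^ 3 + (1 - 2 * t) ^ 3 = 2 + 24 * t\<^sup>2"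
        and e2: "(1 + 2 * t)\<^sup>2 + (1 - 2 * t)\<^sup>2 = 2 + 8 * t\<^sup>2"
        by (simp_all add: eval_nat_numeral algebra_simps)
      have "(t\<^sup>2)\<^sup>2 \<le> a\<^sup>2" using ta by (intro power_mono) auto
      moreover have "t\<^sup>2 * 1 \<le> a * a" using ta a by (intro mult_mono) auto
      moreover have "1 * 1 \<le> a * a" using a by (intro mult_mono) auto
      ultimately have "2 + 48 * t\<^sup>2 + 32 * (t\<^sup>2)\<^sup>2 \<le> 82 * a\<^sup>2" by (simp add: power2_eq_square)
      then have "K * a powr (- p - 3) / 48 * (2 + 48 * t\<^sup>2 + 32 * (t\<^sup>2)\<^sup>2)
          \<le> K * a powr (- p - 3) / 48 * (82 * a\<^sup>2)"
        using K by (intro mult_left_mono) auto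
      also have "\<dots> = 82 / 48 * K * (a powr (- p - 3) * a powr 2)"
        using a by (simp add: powr_numeral)
      also have "a powr (- p - 3) * a powr 2 = a powr (- p - 3 + 2)" by (simp only: powr_add)
      also have "- p - 3 + 2 = - p - 1" by simp
      also have "82 / 48 * K * a powr (- p - 1) \<le> 4 * K * a powr (- p - 1)"
        using K by (intro mult_right_mono) auto
      finally have fourth: "K * a powr (- p - 3) / 48 * ((1 + 2 * t) ^ 4 + (1 - 2 * t) ^ 4)
          \<le> 4 * K * a powr (- p - 1)" unfolding e4 .
      \<comment> \<open>The odd parts cancel between opposite neighbours; what is left of the cubic
        terms has a favourable sign and is dropped.\<close>
      have third: "0 \<le> p * (p + 1) * a powr (- p - 2) / 12 * ((1 + 2 * t) ^ 3 + (1 - 2 * t) ^ 3)"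
        unfolding e3 using p by (intro mult_nonneg_nonneg) auto
      have second: "p * a powr (- p - 1) / 4 * ((1 + 2 * t)\<^sup>2 + (1 - 2 * t)\<^sup>2) =
          p * a powr (- p - 1) / 2 * (1 + 4 * t\<^sup>2)" unfolding e2 by (simp add: field_simps)
      have "pot p (a + (1 + 2 * t)) + pot p (a + (1 - 2 * t)) \<le>
          2 * pot p a - a powr (- p) / 2 * ((1 + 2 * t) + (1 - 2 * t))
          + p * a powr (- p - 1) / 4 * ((1 + 2 * t)\<^sup>2 + (1 - 2 * t)\<^sup>2)
          - p * (p + 1) * a powr (- p - 2) / 12 * ((1 + 2 * t) ^ 3 + (1 - 2 * t) ^ 3)
          + K * a powr (- p - 3) / 48 * ((1 + 2 * t) ^ 4 + (1 - 2 * t) ^ 4)"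
        using pot_Taylor_le [of a "1 + 2 * t" p] pot_Taylor_le [of a "1 - 2 * t" p] small a p
        unfolding K_def [symmetric] unfolding distrib_left by linarith
      moreover have "a powr (- p) / 2 * ((1 + 2 * t) + (1 - 2 * t)) = a powr (- p)" by simp
      ultimately show ?thesis using second third fourth by linarith
    qed
    have "lap (radial_pot c) x = (\<Sum>i\<in>UNIV. pot p (a + (1 + 2 * real_of_int (x $ i)))
        + pot p (a + (1 - 2 * real_of_int (x $ i))) - 2 * pot p a)"
      unfolding lap_def radial_pot_def norm_rvec_add_axis
      by (intro sum.cong) (simp_all add: a_def s_def p_def d_def algebra_simps)
    also have "\<dots> \<le> (\<Sum>i\<in>(UNIV :: 'd set). - (a powr (- p))
        + p * a powr (- p - 1) / 2 * (1 + 4 * (real_of_int (x $ i))\<^sup>2) + 4 * K * a powr (- p - 1))"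
      by (intro sum_mono bound) (auto simp: s intro: member_le_sum)
    also have "\<dots> = - d * a powr (- p) + p * a powr (- p - 1) / 2 * (d + 4 * s) + d * (4 * K * a powr (- p - 1))"
      unfolding sum.distrib sum_distrib_left [symmetric] s by (simp add: d_def)
    \<comment> \<open>The terms d s cancel because p = d / 2: this is the harmonicity of the
      continuum potential.\<close>
    also have "a powr (- p) = a * a powr (- p - 1)"
      using a powr_add [of a 1 "- p - 1"] by simp
    also have "- d * (a * a powr (- p - 1)) + p * a powr (- p - 1) / 2 * (d + 4 * s) + d * (4 * K * a powr (- p - 1))
        = - (d * a powr (- p - 1)) * (c - d / 4 - 4 * K)"
      by (simp add: a_def p_def field_simps)
    also have "\<dots> < 0" using d a by (simp add: c_def mult_pos_pos)
    finally show ?thesis .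
  qed
  then show ?thesis using c by (intro exI [of _ c]) auto
qed

text \<open>With p = d / 2 and \<open>a\<close> the squared norm, this is the radial solution of the
  obstacle problem: quadratic growth plus a multiple of the potential, with both constants chosen so
  that value and slope vanish at the free boundary a = b.\<close>

definition bowl :: "real \<Rightarrow> real \<Rightarrow> real \<Rightarrow> real" where
  "bowl p b a = (a - b) + 2 * b powr p * (pot p a - pot p b)"

lemma has_derivative_bowl:
  "0 < a \<Longrightarrow> (bowl p b has_real_derivative 1 - b powr p * a powr (- p)) (at a)"
  unfolding bowl_def [abs_def]
  by (auto intro!: derivative_eq_intros has_derivative_pot simp: field_simps)

lemma bowl_self [simp]: "bowl p b b = 0"
  by (simp add: bowl_def)

lemma bowl_mvt:
  assumes "0 < a" "0 < b" "a \<noteq> b"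
  obtains z where "min a b < z" "z < max a b" "bowl p b a = (a - b) * (1 - b powr p * z powr (- p))"
proof (cases "a < b")
  case True
  obtain z where z: "a < z" "z < b" "bowl p b b - bowl p b a = (b - a) * (1 - b powr p * z powr (- p))"
    using MVT2 [OF True has_derivative_bowl] assms by (metis less_le_trans)
  show ?thesis by (rule that [of z]) (use z True in \<open>auto simp: algebra_simps\<close>)
next
  case False
  then have "b < a" using assms by simp
  then obtain z where z: "b < z" "z < a" "bowl p b a - bowl p b b = (a - b) * (1 - b powr p * z powr (- p))"
    using MVT2 [OF _ has_derivative_bowl] assms by (metis less_le_trans)
  show ?thesis by (rule that [of z]) (use z in auto)
qed

text \<open>The derivative 1 - (b / z)^p is at most 0 below \<open>b\<close> and at least 0 above,
  so \<open>b\<close> is a minimum.\<close>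

lemma bowl_nonneg:
  assumes "0 < a" "0 < b" "0 \<le> p"
  shows "0 \<le> bowl p b a"
proof (cases "a = b")
  case False
  obtain z where z: "min a b < z" "z < max a b" "bowl p b a = (a - b) * (1 - b powr p * z powr (- p))"
    using bowl_mvt [OF assms(1,2) False] .
  then have z0: "0 < z" using assms by linarith
  have eq: "b powr p * z powr (- p) = (b / z) powr p"
    using assms z0 by (simp add: powr_divide powr_minus_divide)
  show ?thesis
  proof (cases "a < b")
    case True
    have "1 powr p \<le> (b / z) powr p" using z True assms z0 by (intro powr_mono2) auto
    then show ?thesis unfolding z(3) eq using True by (intro mult_nonpos_nonpos) auto
  next
    case False
    then have "(b / z) powr p \<le> 1 powr p" using z assms z0 by (intro powr_mono2) auto
    then show ?thesis unfolding z(3) eq using False by (intro mult_nonneg_nonneg) auto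
  qed
qed simp

lemma bowl_le:
  assumes "0 < b" "b \<le> a" "0 \<le> p"
  shows "bowl p b a \<le> p * (a - b)\<^sup>2 / b"
proof (cases "a = b")
  case False
  have a: "0 < a" using assms by linarith
  obtain z where z: "min a b < z" "z < max a b" "bowl p b a = (a - b) * (1 - b powr p * z powr (- p))"
    using bowl_mvt [OF a assms(1) False] .
  then have bz: "b < z" "z < a" using assms by auto
  have "\<exists>y. b < y \<and> y < z \<and> z powr (- p) - b powr (- p) = (z - b) * (- p * y powr (- p - 1))"
    using assms by (intro MVT2 bz has_real_derivative_powr) auto
  then obtain y where y: "b < y" "z powr (- p) - b powr (- p) = (z - b) * (- p * y powr (- p - 1))"
    by blast
  have "y powr (- p - 1) \<le> b powr (- p - 1)" using y assms by (intro powr_mono2') auto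
  then have "(z - b) * (p * y powr (- p - 1)) \<le> (a - b) * (p * b powr (- p - 1))"
    using bz assms by (intro mult_mono) auto
  then have "b powr (- p) - z powr (- p) \<le> (a - b) * (p * b powr (- p - 1))" using y by simp
  then have "b powr p * (b powr (- p) - z powr (- p)) \<le> b powr p * ((a - b) * (p * b powr (- p - 1)))"
    by (intro mult_left_mono) auto
  also have "\<dots> = p * (a - b) * (b powr p * b powr (- p - 1))" by simp
  also have "b powr p * b powr (- p - 1) = 1 / b"
    using assms by (simp add: powr_minus_divide flip: powr_add)
  also have "b powr p * (b powr (- p) - z powr (- p)) = 1 - b powr p * z powr (- p)"
    using assms by (simp add: right_diff_distrib flip: powr_add)
  finally have "bowl p b a \<le> (a - b) * (p * (a - b) * (1 / b))"
    unfolding z(3) using assms by (intro mult_left_mono) auto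
  then show ?thesis by (simp add: power2_eq_square mult_ac)
qed simp

definition radial_bowl :: "real \<Rightarrow> real \<Rightarrow> int ^ 'd::finite \<Rightarrow> real" where
  "radial_bowl c b x = bowl (real CARD('d) / 2) b ((norm (rvec x))\<^sup>2 + c)"

lemma lap_norm_sq: "lap (\<lambda>x. (norm (rvec x))\<^sup>2) (x :: int ^ 'd::finite) = 2 * real CARD('d)"
  unfolding lap_def norm_rvec_add_axis by simp

lemma lap_radial_bowl:
  "lap (radial_bowl c b) (x :: int ^ 'd::finite)
    = 2 * real CARD('d) + 2 * b powr (real CARD('d) / 2) * lap (radial_pot c) x"
proof -
  have "radial_bowl c b = (\<lambda>x :: int ^ 'd. ((norm (rvec x))\<^sup>2 +
      (2 * b powr (real CARD('d) / 2)) * radial_pot c x) +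
      (c - b - 2 * b powr (real CARD('d) / 2) * pot (real CARD('d) / 2) b))"
    by (simp add: fun_eq_iff radial_bowl_def bowl_def radial_pot_def algebra_simps)
  then show ?thesis by (simp add: lap_add lap_cmult lap_norm_sq)
qed

lemma radial_bowl_nonneg: "0 < c \<Longrightarrow> 0 < b \<Longrightarrow> 0 \<le> radial_bowl c b x"
  unfolding radial_bowl_def by (intro bowl_nonneg add_nonneg_pos) auto

text \<open>Quadratic vanishing at the free boundary: across a unit shell a - b is at most 2 r + 1,
  and its square is at most 8 b. The bound is thus free of \<open>r\<close>, so cutting the bowl off
  at its edge costs only a constant per boundary site.\<close>

lemma radial_bowl_le:
  fixes x :: "int ^ 'd::finite"
  assumes "1 \<le> c" "0 \<le> r" "r \<le> norm (rvec x)" "norm (rvec x) \<le> r + 1"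
  shows "radial_bowl c (r\<^sup>2 + c) x \<le> 4 * real CARD('d)"
proof -
  let ?p = "real CARD('d) / 2" and ?a = "(norm (rvec x))\<^sup>2 + c" and ?b = "r\<^sup>2 + c"
  have b: "0 < ?b" using assms by (intro add_nonneg_pos) auto
  have lower: "r\<^sup>2 \<le> (norm (rvec x))\<^sup>2" and upper: "(norm (rvec x))\<^sup>2 \<le> (r + 1)\<^sup>2"
    using assms by (auto intro!: power_mono)
  have "radial_bowl c ?b x \<le> ?p * (?a - ?b)\<^sup>2 / ?b"
    unfolding radial_bowl_def using b lower by (intro bowl_le) auto
  also have "\<dots> \<le> ?p * (8 * ?b) / ?b"
  proof -
    have "(?a - ?b)\<^sup>2 \<le> (2 * r + 1)\<^sup>2"
      using lower upper by (intro power_mono) (auto simp: power2_eq_square algebra_simps)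
    also have "\<dots> \<le> 8 * ?b"
      using assms zero_le_power2 [of "2 * r - 1"] by (simp add: power2_eq_square algebra_simps)
    finally show ?thesis using b by (intro divide_right_mono mult_left_mono) auto
  qed
  also have "\<dots> = 4 * real CARD('d)"
  proof -
    have "?p * (8 * t) / t = 4 * real CARD('d)" if "0 < t" for t using that by simp
    from this [OF b] show ?thesis .
  qed
  finally show ?thesis .
qed

subsection \<open>The total mass of the smoothed point source\<close>

text \<open>Over the whole lattice the Laplacian sums to 0, and outside \<open>L\<close>, where
  \<open>G\<close> is 0, its terms are nonnegative.\<close>

lemma sum_lap_nonpos:
  fixes G :: "int ^ 'd::finite \<Rightarrow> real"
  assumes "finite L" "\<And>x. 0 \<le> G x" "\<And>x. x \<notin> L \<Longrightarrow> G x = 0"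
  shows "(\<Sum>x\<in>L. lap G x) \<le> 0"
proof -
  have shift: "(\<Sum>x\<in>L. G (x + a)) \<le> (\<Sum>x\<in>L. G x)" for a
  proof -
    have "(\<Sum>x\<in>L. G (x + a)) = (\<Sum>x\<in>(\<lambda>x. x + a) ` L. G x)"
      by (simp add: sum.reindex inj_on_def)
    also have "\<dots> = (\<Sum>x\<in>(\<lambda>x. x + a) ` L \<inter> L. G x)"
      using assms by (intro sum.mono_neutral_right) auto
    also have "\<dots> \<le> (\<Sum>x\<in>L. G x)" using assms by (intro sum_mono2) auto
    finally show ?thesis .
  qed
  have "(\<Sum>x\<in>L. lap G x) = (\<Sum>i\<in>UNIV. (\<Sum>x\<in>L. G (x + axis i 1)) + (\<Sum>x\<in>L. G (x + - axis i 1))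
      - 2 * (\<Sum>x\<in>L. G x))"
    unfolding lap_def by (subst sum.swap) (simp add: sum.distrib sum_subtractf sum_distrib_left)
  also have "\<dots> \<le> (\<Sum>i\<in>(UNIV :: 'd set). 0)"
  proof (rule sum_mono)
    fix i :: 'd
    show "(\<Sum>x\<in>L. G (x + axis i 1)) + (\<Sum>x\<in>L. G (x + - axis i 1)) - 2 * (\<Sum>x\<in>L. G x) \<le> 0"
      using shift [of "axis i 1"] shift [of "- axis i 1"] by linarith
  qed
  finally show ?thesis by simp
qed

lemma lball_nbrs: "x \<in> lball (r - 1) \<Longrightarrow> y \<in> nbrs x \<Longrightarrow> y \<in> lball r"
  using norm_rvec_nbrs [of y x] by (auto simp: lball_def)

text \<open>Mass balance for the bowl cut off at radius \<open>r\<close>: the 2 d per site coming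
  from the squared norm must be compensated by the kernel. The cut affects only the outermost unit
  shell, by at most 2 d neighbours times 4 d per site.\<close>

lemma mass_radial_pot_ge:
  assumes "1 \<le> c" "0 \<le> r"
  shows "real CARD('d::finite) * real (card (lball r :: (int ^ 'd) set))
      - 4 * (real CARD('d))\<^sup>2 * (real (card (lball r :: (int ^ 'd) set))
        - real (card (lball (r - 1) :: (int ^ 'd) set)))
    \<le> (r\<^sup>2 + c) powr (real CARD('d) / 2) * (\<Sum>x\<in>(lball r :: (int ^ 'd) set). - lap (radial_pot c) x)"
proof -
  define d where "d = real CARD('d)"
  define L where "L = (lball r :: (int ^ 'd) set)"
  define L' where "L' = (lball (r - 1) :: (int ^ 'd) set)"
  define b where "b = r\<^sup>2 + c"
  define B where "B = (radial_bowl c b :: int ^ 'd \<Rightarrow> real)"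
  define G where "G x = (if x \<in> L then B x else 0)" for x
  have c: "0 < c" using assms by simp
  then have b: "0 < b" unfolding b_def by (intro add_nonneg_pos) auto
  have fin: "finite L" "finite L'" and sub: "L' \<subseteq> L"
    using lball_mono [of "r - 1" r] by (auto simp: L_def L'_def)
  have B0: "0 \<le> B x" for x unfolding B_def by (rule radial_bowl_nonneg [OF c b])
  have near: "B y \<le> G y + 4 * d" if "y \<in> nbrs x" "x \<in> L" for x y
  proof (cases "y \<in> L")
    case False
    have "norm (rvec y) \<le> r + 1" using norm_rvec_nbrs [OF that(1)] that(2) by (simp add: L_def lball_def)
    moreover have "r \<le> norm (rvec y)" using False by (simp add: L_def lball_def)
    ultimately have "B y \<le> 4 * d" unfolding B_def b_def d_def using assms by (intro radial_bowl_le) auto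
    then show ?thesis using False by (simp add: G_def)
  qed (simp add: G_def d_def)
  have lap_B: "lap B x \<le> lap G x + (if x \<in> L' then 0 else 8 * d\<^sup>2)" if x: "x \<in> L" for x
  proof (cases "x \<in> L'")
    case True
    then have "G y = B y" if "y \<in> nbrs x" for y
      using lball_nbrs [of x r y] that by (simp add: G_def L_def L'_def)
    then show ?thesis using True x by (simp add: lap_nbrs G_def)
  next
    case False
    have "(\<Sum>y\<in>nbrs x. B y) \<le> (\<Sum>y\<in>nbrs x. G y + 4 * d)" using near x by (intro sum_mono) auto
    also have "\<dots> = (\<Sum>y\<in>nbrs x. G y) + real (card (nbrs x)) * (4 * d)" by (simp add: sum.distrib)
    also have "real (card (nbrs x)) * (4 * d) \<le> (2 * d) * (4 * d)"
      using card_nbrs_le [of x] by (intro mult_right_mono) (auto simp: d_def)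
    finally show ?thesis using False x by (simp add: lap_nbrs G_def power2_eq_square)
  qed
  have "(\<Sum>x\<in>L. lap B x) \<le> (\<Sum>x\<in>L. lap G x) + (\<Sum>x\<in>L. if x \<in> L' then 0 else 8 * d\<^sup>2)"
    unfolding sum.distrib [symmetric] by (intro sum_mono lap_B)
  also have "(\<Sum>x\<in>L. if x \<in> L' then 0 else 8 * d\<^sup>2) = 8 * d\<^sup>2 * (real (card L) - real (card L'))"
  proof -
    have "L \<inter> - L' = L - L'" by blast
    moreover have "real (card (L - L')) = real (card L) - real (card L')"
      using card_mono [OF fin(1) sub] by (simp add: card_Diff_subset [OF fin(2) sub])
    ultimately show ?thesis using fin by (simp add: sum.If_cases)
  qed
  also have "(\<Sum>x\<in>L. lap G x) \<le> 0"
    using fin B0 by (intro sum_lap_nonpos) (auto simp: G_def)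
  also have "(\<Sum>x\<in>L. lap B x) = 2 * d * real (card L) - 2 * b powr (d / 2) * (\<Sum>x\<in>L. - lap (radial_pot c) x)"
    unfolding B_def lap_radial_bowl sum.distrib sum_distrib_left [symmetric] sum_negf
    by (simp add: d_def)
  finally show ?thesis unfolding b_def L_def L'_def d_def by simp
qed

text \<open>Mass balance divided by the power of \<open>r\<close>. The constant ties the radius to
  \<open>n\<close>: for q = d \<omega>_d the later relation n d = q R^d says that the ball of radius
  \<open>R\<close> has volume \<open>n\<close>.\<close>

lemma mass_radial_pot_eventually:
  assumes c: "1 \<le> c" and y: "y < real CARD('d::finite) * unit_ball_vol (real CARD('d))"
  shows "\<forall>\<^sub>F r in at_top. y < (\<Sum>x\<in>(lball r :: (int ^ 'd) set). - lap (radial_pot c) x)"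
proof -
  define d where "d = real CARD('d)"
  define v where "v = unit_ball_vol d"
  define N where "N r = real (card (lball r :: (int ^ 'd) set))" for r
  define M where "M r = (\<Sum>x\<in>(lball r :: (int ^ 'd) set). - lap (radial_pot c) x)" for r
  have N: "((\<lambda>r. N r / r ^ CARD('d)) \<longlongrightarrow> v) at_top" "((\<lambda>r. N (r - 1) / r ^ CARD('d)) \<longlongrightarrow> v) at_top"
    unfolding N_def v_def d_def by (rule card_lball_asymp card_lball_asymp_shift)+
  have "((\<lambda>r. c / r\<^sup>2) \<longlongrightarrow> 0) at_top"
    by (rule real_tendsto_divide_at_top [OF tendsto_const filterlim_pow_at_top]) (auto simp: filterlim_ident)
  then have pw: "((\<lambda>r. (1 + c / r\<^sup>2) powr (- (d / 2))) \<longlongrightarrow> (1 + 0) powr (- (d / 2))) at_top"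
    by (intro tendsto_intros) auto
  have "((\<lambda>r. (d * (N r / r ^ CARD('d)) - 4 * d\<^sup>2 * (N r / r ^ CARD('d) - N (r - 1) / r ^ CARD('d)))
      * (1 + c / r\<^sup>2) powr (- (d / 2))) \<longlongrightarrow> (d * v - 4 * d\<^sup>2 * (v - v)) * (1 + 0) powr (- (d / 2))) at_top"
    by (intro tendsto_mult tendsto_diff tendsto_const N pw)
  then have "\<forall>\<^sub>F r in at_top. y < (d * (N r / r ^ CARD('d))
      - 4 * d\<^sup>2 * (N r / r ^ CARD('d) - N (r - 1) / r ^ CARD('d))) * (1 + c / r\<^sup>2) powr (- (d / 2))"
    by (rule order_tendstoD) (use y in \<open>simp add: d_def v_def\<close>)
  then show ?thesis
    using eventually_gt_at_top [of 0]
  proof eventually_elim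
    case (elim r)
    have b: "0 < r\<^sup>2 + c" using c by (intro add_nonneg_pos) auto
    have "r ^ CARD('d) = (r\<^sup>2) powr (d / 2)"
      using elim by (simp add: d_def powr_powr flip: powr_realpow powr_numeral)
    moreover have "1 + c / r\<^sup>2 = (r\<^sup>2 + c) / r\<^sup>2" using elim by (simp add: field_simps)
    ultimately have pw: "(1 + c / r\<^sup>2) powr (- (d / 2)) = r ^ CARD('d) / (r\<^sup>2 + c) powr (d / 2)"
      using elim b by (simp add: powr_divide powr_minus field_simps)
    have rd: "0 < r ^ CARD('d)" using elim by simp
    have "y < (d * (N r / r ^ CARD('d)) - 4 * d\<^sup>2 * (N r / r ^ CARD('d) - N (r - 1) / r ^ CARD('d)))
        * (r ^ CARD('d) / (r\<^sup>2 + c) powr (d / 2))" using elim pw by simp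
    also have "\<dots> = (d * N r - 4 * d\<^sup>2 * (N r - N (r - 1))) / (r\<^sup>2 + c) powr (d / 2)"
      using rd b elim by (simp add: field_simps)
    also have "\<dots> \<le> ((r\<^sup>2 + c) powr (d / 2) * M r) / (r\<^sup>2 + c) powr (d / 2)"
      using mass_radial_pot_ge [where 'd = 'd, of c r] c elim
      by (intro divide_right_mono) (auto simp: N_def M_def d_def)
    also have "\<dots> = M r" using b by simp
    finally show ?case by (simp add: M_def)
  qed
qed

subsection \<open>Comparison of the odometer with the continuum profile\<close>

definition l1 :: "int ^ 'd::finite \<Rightarrow> nat" where
  "l1 v = (\<Sum>i\<in>UNIV. nat \<bar>v $ i\<bar>)"

lemma l1_step:
  fixes v :: "int ^ 'd::finite"
  assumes "l1 v = Suc m"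
  obtains w where "l1 w = m" "v \<in> nbrs w"
proof -
  obtain i where i: "v $ i \<noteq> 0" using assms by (force simp: l1_def)
  define w where "w = v - axis i (sgn (v $ i))"
  have "l1 v = nat \<bar>v $ i\<bar> + (\<Sum>j\<in>UNIV - {i}. nat \<bar>v $ j\<bar>)"
    unfolding l1_def by (intro sum.remove) auto
  moreover have "l1 w = nat \<bar>w $ i\<bar> + (\<Sum>j\<in>UNIV - {i}. nat \<bar>w $ j\<bar>)"
    unfolding l1_def by (intro sum.remove) auto
  moreover have "(\<Sum>j\<in>UNIV - {i}. nat \<bar>w $ j\<bar>) = (\<Sum>j\<in>UNIV - {i}. nat \<bar>v $ j\<bar>)"
    by (intro sum.cong) (auto simp: w_def axis_def)
  moreover have "nat \<bar>v $ i\<bar> = Suc (nat \<bar>w $ i\<bar>)"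
    using i by (auto simp: w_def axis_def sgn_if split: if_splits)
  ultimately have "l1 w = m" using assms by simp
  moreover have "v \<in> nbrs w"
  proof (cases "v $ i > 0")
    case True
    then have "v = w + axis i 1" by (simp add: w_def)
    then show ?thesis by (auto simp: nbrs_def)
  next
    case False
    then have "v = w - axis i 1" using i by (simp add: w_def vec_eq_iff axis_def)
    then show ?thesis by (auto simp: nbrs_def)
  qed
  ultimately show thesis by (rule that)
qed

text \<open>A crude Harnack inequality. As \<sigma> is nonnegative, the neighbours of a site
  together have at most 2 d + 2 d u, so each step away from a zero multiplies the bound by at most 4
  d.\<close>

lemma stabilizes_growth:
  fixes u :: "int ^ 'd::finite \<Rightarrow> int"
  assumes st: "stabilizes \<sigma> u" and \<sigma>: "\<And>x. 0 \<le> \<sigma> x" and "u y = 0"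
  shows "u (y + v) \<le> (4 * int CARD('d)) ^ l1 v"
proof (induction "l1 v" arbitrary: v)
  case 0
  then have "v = 0" by (simp add: l1_def vec_eq_iff)
  then show ?case using assms(3) by (simp add: l1_def)
next
  case (Suc m)
  obtain w where w: "l1 w = m" "v \<in> nbrs w" using Suc.hyps(2) l1_step by metis
  have nb: "y + v \<in> nbrs (y + w)" using w(2) by (force simp: nbrs_def)
  have nonneg: "0 \<le> u x" for x using st by (simp add: stabilizes_def)
  have "u (y + v) \<le> (\<Sum>z\<in>nbrs (y + w). u z)"
    using nb nonneg by (intro member_le_sum) auto
  also have "\<dots> = lap u (y + w) + 2 * int CARD('d) * u (y + w)" by (simp add: lap_nbrs)
  also have "\<dots> \<le> 2 * int CARD('d) + 2 * int CARD('d) * u (y + w)"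
    using st \<sigma> [of "y + w"] by (simp add: stabilizes_def) (smt (verit))
  also have "\<dots> \<le> 2 * int CARD('d) * (4 * int CARD('d)) ^ m + 2 * int CARD('d) * (4 * int CARD('d)) ^ m"
  proof -
    have "0 < int CARD('d)" by simp
    then have "1 \<le> (4 * int CARD('d)) ^ m" by (intro one_le_power) linarith
    then have "2 * int CARD('d) * 1 \<le> 2 * int CARD('d) * (4 * int CARD('d)) ^ m" by (intro mult_left_mono) auto
    moreover have "2 * int CARD('d) * u (y + w) \<le> 2 * int CARD('d) * (4 * int CARD('d)) ^ m"
      using Suc.hyps(1) [of w] w(1) by (intro mult_left_mono) auto
    ultimately show ?thesis by linarith
  qed
  also have "\<dots> = (4 * int CARD('d)) ^ l1 v" by (simp flip: Suc.hyps(2))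
  finally show ?case .
qed

lemma internal_edges_translate:
  "internal_edges ((\<lambda>x. a + x) ` A) = internal_edges (A :: (int ^ 'd::finite) set)"
proof -
  have "{x \<in> (\<lambda>x. a + x) ` A. x + axis i 1 \<in> (\<lambda>x. a + x) ` A} = (\<lambda>x. a + x) ` {x\<in>A. x + axis i 1 \<in> A}" for i
    by (auto simp: image_iff add.assoc)
  then show ?thesis unfolding internal_edges_def by (simp add: card_image)
qed

text \<open>Edges are counted at the endpoint with the smaller coordinate, and every site outside
  the outermost unit shell has all \<open>d\<close> forward neighbours in the ball.\<close>

lemma internal_edges_lball_eventually:
  assumes "0 < \<delta>"
  shows "\<forall>\<^sub>F r in at_top. (real CARD('d) - \<delta>) * real (card (lball r :: (int ^ 'd::finite) set))
    \<le> of_int (internal_edges (lball r :: (int ^ 'd) set))"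
proof -
  define d where "d = real CARD('d)"
  define v where "v = unit_ball_vol d"
  define N where "N r = real (card (lball r :: (int ^ 'd) set))" for r
  have v: "0 < v" unfolding v_def d_def by (rule unit_ball_vol_pos) simp
  have N: "((\<lambda>r. N r / r ^ CARD('d)) \<longlongrightarrow> v) at_top" "((\<lambda>r. N (r - 1) / r ^ CARD('d)) \<longlongrightarrow> v) at_top"
    unfolding N_def v_def d_def by (rule card_lball_asymp card_lball_asymp_shift)+
  have "((\<lambda>r. d * (N (r - 1) / r ^ CARD('d)) - (d - \<delta>) * (N r / r ^ CARD('d))) \<longlongrightarrow> d * v - (d - \<delta>) * v) at_top"
    by (intro tendsto_mult tendsto_diff tendsto_const N)
  then have "\<forall>\<^sub>F r in at_top. 0 < d * (N (r - 1) / r ^ CARD('d)) - (d - \<delta>) * (N r / r ^ CARD('d))"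
    by (rule order_tendstoD) (use v assms in \<open>simp add: algebra_simps\<close>)
  then show ?thesis
    using eventually_gt_at_top [of 0]
  proof eventually_elim
    case (elim r)
    have r: "0 < r ^ CARD('d)" using elim by simp
    have "0 < (d * N (r - 1) - (d - \<delta>) * N r) / r ^ CARD('d)" using elim by (simp add: diff_divide_distrib)
    then have "(d - \<delta>) * N r \<le> d * N (r - 1)" using r elim by (simp add: zero_less_divide_iff)
    also have "d * N (r - 1) = (\<Sum>i\<in>(UNIV :: 'd set). real (card (lball (r - 1) :: (int ^ 'd) set)))"
      by (simp add: d_def N_def)
    also have "\<dots> \<le> (\<Sum>i\<in>UNIV. real (card {x \<in> (lball r :: (int ^ 'd) set). x + axis i 1 \<in> lball r}))"
    proof (intro sum_mono of_nat_mono card_mono)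
      fix i :: 'd
      have "x + axis i 1 \<in> nbrs x" for x :: "int ^ 'd" by (simp add: nbrs_def)
      then show "(lball (r - 1) :: (int ^ 'd) set) \<subseteq> {x \<in> lball r. x + axis i 1 \<in> lball r}"
        using lball_nbrs lball_mono [of "r - 1" r] by fastforce
    qed auto
    also have "\<dots> = of_int (internal_edges (lball r :: (int ^ 'd) set))" by (simp add: internal_edges_def)
    finally show ?case by (simp add: d_def N_def)
  qed
qed

lemma lap_uminus:
  assumes "\<And>x. f (- x) = f x"
  shows "lap f (- x) = lap f x"
proof -
  have "f (- x + axis i 1) = f (x - axis i 1)" "f (- x - axis i 1) = f (x + axis i 1)" for i
    using assms [of "x - axis i 1"] assms [of "x + axis i 1"] by (simp_all add: algebra_simps)
  then show ?thesis by (simp add: lap_def assms add.commute)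
qed

text \<open>
  In the proof, \<open>G\<close> solves the obstacle problem for a smoothed point source. Averaging \<open>u\<close> with the
  kernel \<open>\<kappa>\<close> on \<open>Z\<close> turns its point source into that of \<open>G\<close>, and averaging over \<open>A\<close> turns the burning
  inequality into a lower bound on the Laplacian. The result \<open>U\<close> exceeds the average \<open>H\<close> of \<open>G\<close> by a
  constant at most, since \<open>U - H\<close> has no maximum except close to a zero of \<open>u\<close>, where \<open>U\<close> is bounded.
\<close>

lemma minimal_stabilizer_bounded:
  fixes q :: real
  assumes q: "0 < q" "q < real CARD('d::finite) * unit_ball_vol (real CARD('d))"
  shows "\<exists>C k \<rho>. \<forall>n R (u :: int ^ 'd \<Rightarrow> int) x. \<rho> \<le> R \<longrightarrow> real n * real CARD('d) \<le> q * R ^ CARD('d) \<longrightarrow>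
    stabilizes (const_plus_origin (int CARD('d) - 1) n) u \<longrightarrow>
    (\<forall>w x. stabilizes (const_plus_origin (int CARD('d) - 1) n) w \<longrightarrow> u x \<le> w x) \<longrightarrow>
    finite {x. u x \<noteq> 0} \<longrightarrow> R + k < norm (rvec x) \<longrightarrow> real_of_int (u x) \<le> C"
proof -
  define d where "d = real CARD('d)"
  obtain c where c: "1 \<le> c" and super: "\<And>x :: int ^ 'd. lap (radial_pot c) x < 0"
    using radial_pot_superharmonic by blast
  obtain q' where q': "q < q'" "q' < d * unit_ball_vol d"
    using dense [OF q(2)] by (auto simp: d_def)
  \<comment> \<open>The density loss that the surplus of kernel mass, q' against q, can pay
    for.\<close>
  define \<delta> where "\<delta> = 1 - q / q'"
  have \<delta>: "0 < \<delta>" "(1 - \<delta>) * q' = q" using q q' by (simp_all add: \<delta>_def)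
  define \<kappa> where "\<kappa> x = - lap (radial_pot c) x" for x :: "int ^ 'd"
  have \<kappa>: "0 < \<kappa> x" for x using super by (simp add: \<kappa>_def)
  have \<kappa>_even: "\<kappa> (- x) = \<kappa> x" for x
    unfolding \<kappa>_def by (subst lap_uminus) (simp_all add: radial_pot_def)
  have "\<forall>\<^sub>F r in at_top. 0 < r \<and> q' < (\<Sum>x\<in>lball r. \<kappa> x)"
    using mass_radial_pot_eventually [OF c, where 'd = 'd, of q'] q'
    by (intro eventually_conj eventually_gt_at_top) (simp add: \<kappa>_def d_def)
  then obtain \<rho> where \<rho>: "0 < \<rho>" "q' < (\<Sum>x\<in>lball \<rho>. \<kappa> x)"
    using eventually_happens trivial_limit_at_top_linorder by blast
  define Z where "Z = (lball \<rho> :: (int ^ 'd) set)"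
  have "\<forall>\<^sub>F r in at_top. 0 < r \<and> (d - \<delta>) * real (card (lball r :: (int ^ 'd) set))
    \<le> of_int (internal_edges (lball r :: (int ^ 'd) set))"
    using internal_edges_lball_eventually [OF \<delta>(1), where 'd = 'd]
    by (intro eventually_conj eventually_gt_at_top) (simp add: d_def)
  then obtain k where k: "0 < k" "(d - \<delta>) * real (card (lball k :: (int ^ 'd) set))
    \<le> of_int (internal_edges (lball k :: (int ^ 'd) set))"
    using eventually_happens trivial_limit_at_top_linorder by blast
  define A where "A = (lball k :: (int ^ 'd) set)"
  have fin: "finite Z" "finite A" by (simp_all add: Z_def A_def)
  have zero: "0 \<in> Z" "0 \<in> A" using \<rho> k by (simp_all add: Z_def A_def)
  have cardA: "0 < real (card A)" using zero fin by (auto simp: card_gt_0_iff)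
  \<comment> \<open>All displacements between two points seen by the same average. Hence
    \<open>B\<close> bounds \<open>u\<close> at every such point as soon as one of them is a zero of
    \<open>u\<close>, and \<open>CB\<close> bounds the average.\<close>
  define V where "V = (\<lambda>(z, b, z', b'). z' + b' - (z + b)) ` (Z \<times> A \<times> Z \<times> A)"
  define B where "B = real_of_int (\<Sum>v\<in>V. (4 * int CARD('d)) ^ l1 v)"
  have finV: "finite V" using fin by (simp add: V_def)
  define CB where "CB = (\<Sum>z\<in>Z. \<kappa> z * (\<Sum>b\<in>A. B))"
  have "0 \<le> B" by (simp add: B_def sum_nonneg)
  then have CB: "0 \<le> CB" unfolding CB_def using less_imp_le [OF \<kappa>] by (intro sum_nonneg mult_nonneg_nonneg) auto
  have main: "real_of_int (u x) \<le> (2 * q * real (card A) + CB) / \<kappa> 0"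
    if R: "\<rho> \<le> R" "real n * real CARD('d) \<le> q * R ^ CARD('d)"
      and st: "stabilizes (const_plus_origin (int CARD('d) - 1) n) u"
      and min: "\<And>w x. stabilizes (const_plus_origin (int CARD('d) - 1) n) w \<Longrightarrow> u x \<le> w x"
      and fin_u: "finite {x. u x \<noteq> 0}" and x: "R + k < norm (rvec x)"
    for n R and u :: "int ^ 'd \<Rightarrow> int" and x
  proof -
    define \<sigma> where "\<sigma> = (const_plus_origin (int CARD('d) - 1) n :: 'd config)"
    have u0: "0 \<le> u y" for y using st by (simp add: stabilizes_def)
    have "0 < int CARD('d)" by simp
    then have d1: "1 \<le> int CARD('d)" by linarith
    define U where "U = (\<lambda>x. \<Sum>z\<in>Z. \<kappa> z * (\<Sum>b\<in>A. real_of_int (u (x + (z + b)))))"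
    define g where "g = (\<lambda>y :: int ^ 'd. q / (2 * d) * radial_bowl c (R\<^sup>2 + c) y)"
    \<comment> \<open>The continuum solution is 0 outside the ball, whereas \<open>g\<close> grows
      again there. Cutting at 2 q is harmless: this is the bound on \<open>g\<close> in the unit
      shell around the ball, so the two branches fit together without a jump.\<close>
    define G where "G y = (if norm (rvec y) \<le> R then g y else min (g y) (2 * q))" for y
    define H where "H = (\<lambda>x. \<Sum>b\<in>A. G (x + b))"
    have R0: "0 < R" using R \<rho> by linarith
    have b0: "0 < R\<^sup>2 + c" using c by (intro add_nonneg_pos) auto
    have d0: "0 < d" by (simp add: d_def)
    have g0: "0 \<le> g y" for y
      unfolding g_def using q d0 c b0 by (intro mult_nonneg_nonneg radial_bowl_nonneg) auto
    have G0: "0 \<le> G y" for y using g0 q by (simp add: G_def)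
    have H0: "0 \<le> H y" for y unfolding H_def by (intro sum_nonneg G0)
    have Gg: "G y \<le> g y" for y by (simp add: G_def)
    have G_out: "G y \<le> 2 * q" if "R < norm (rvec y)" for y using that by (simp add: G_def)
    have g_edge: "g y \<le> 2 * q" if "R \<le> norm (rvec y)" "norm (rvec y) \<le> R + 1" for y
    proof -
      have "g y \<le> q / (2 * d) * (4 * d)"
        unfolding g_def using radial_bowl_le [OF c less_imp_le [OF R0] that] q d0
        by (intro mult_left_mono) (auto simp: d_def)
      then show ?thesis using d0 by simp
    qed
    have lap_g: "lap g y \<le> q - real n * \<kappa> y" for y
    proof -
      have "R ^ CARD('d) = (R\<^sup>2) powr (d / 2)"
        using R0 by (simp add: d_def powr_powr flip: powr_realpow powr_numeral)
      also have "\<dots> \<le> (R\<^sup>2 + c) powr (d / 2)" using c d0 by (intro powr_mono2) auto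
      finally have "q * R ^ CARD('d) \<le> q * (R\<^sup>2 + c) powr (d / 2)" using q by (intro mult_left_mono) auto
      then have "real n * d \<le> q * (R\<^sup>2 + c) powr (d / 2)" using R(2) by (simp add: d_def)
      then have "real n \<le> q / d * (R\<^sup>2 + c) powr (d / 2)" using d0 by (simp add: field_simps)
      then have "real n * \<kappa> y \<le> q / d * (R\<^sup>2 + c) powr (d / 2) * \<kappa> y"
        using \<kappa> [of y] by (intro mult_right_mono) auto
      moreover have "lap g y = q - q / d * (R\<^sup>2 + c) powr (d / 2) * \<kappa> y"
        unfolding g_def lap_cmult lap_radial_bowl using d0 by (simp add: \<kappa>_def d_def field_simps)
      ultimately show ?thesis by simp
    qed
    have lap_G: "lap G y \<le> q - real n * (if y \<in> Z then \<kappa> y else 0)" for y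
    proof (cases "G y = g y")
      case True
      then have "lap G y \<le> lap g y" using Gg by (intro lap_le)
      also have "\<dots> \<le> q - real n * \<kappa> y" by (rule lap_g)
      also have "\<dots> \<le> q - real n * (if y \<in> Z then \<kappa> y else 0)" using \<kappa> [of y] by auto
      finally show ?thesis .
    next
      case False
      then have y: "R < norm (rvec y)" "G y = 2 * q" "2 * q < g y" by (auto simp: G_def min_def split: if_splits)
      have "lap G y \<le> lap (\<lambda>_. 2 * q) y"
      proof (rule lap_le)
        fix z assume z: "z \<in> nbrs y"
        \<comment> \<open>A neighbour inside the ball would put \<open>y\<close> into the unit
          shell, where \<open>g\<close> is at most 2 q.\<close>
        have "\<not> norm (rvec z) \<le> R"
          using norm_rvec_nbrs [of y z] z g_edge [of y] y by (auto simp: nbrs_sym [of z y])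
        then show "G z \<le> 2 * q" by (simp add: G_out)
      qed (use y in simp)
      moreover have "y \<notin> Z" using y R by (simp add: Z_def lball_def)
      ultimately show ?thesis using q by simp
    qed
    have bad: "U y \<le> CB" if "z \<in> Z" "b \<in> A" "u (y + (z + b)) = 0" for y z b
    proof -
      have "real_of_int (u (y + (z' + b'))) \<le> B" if z': "z' \<in> Z" "b' \<in> A" for z' b'
      proof -
        define v where "v = z' + b' - (z + b)"
        have v: "v \<in> V" unfolding V_def v_def using that \<open>z \<in> Z\<close> \<open>b \<in> A\<close> by force
        have "u (y + (z' + b')) = u (y + (z + b) + v)" by (simp add: v_def algebra_simps)
        also have "\<dots> \<le> (4 * int CARD('d)) ^ l1 v"
          by (rule stabilizes_growth [OF st]) (use that d1 \<open>u (y + (z + b)) = 0\<close> in \<open>auto simp: const_plus_origin_def\<close>)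
        also have "\<dots> \<le> (\<Sum>v\<in>V. (4 * int CARD('d)) ^ l1 v)"
          using finV v by (intro member_le_sum) auto
        finally show ?thesis unfolding B_def by (rule of_int_le_iff [THEN iffD2])
      qed
      then show ?thesis unfolding U_def CB_def using less_imp_le [OF \<kappa>] by (intro sum_mono mult_left_mono) auto
    qed
    have good: "0 < lap (\<lambda>x. U x - H x) y" if pos: "\<And>z b. z \<in> Z \<Longrightarrow> b \<in> A \<Longrightarrow> u (y + (z + b)) \<noteq> 0" for y
    proof -
      have avg: "(1 - \<delta>) * real (card A) - real n * (\<Sum>b\<in>A. if z = - (y + b) then 1 else 0)
          \<le> (\<Sum>b\<in>A. real_of_int (lap u (y + (z + b))))" if z: "z \<in> Z" for z
      proof -
        let ?T = "(\<lambda>b. (y + z) + b) ` A"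
        \<comment> \<open>No point of this translate of \<open>A\<close> is a zero of
          \<open>u\<close>, so burning applies to it; the origin contributes its \<open>n\<close>
          particles when it lies in the translate.\<close>
        have "internal_edges ?T \<le> (\<Sum>x\<in>?T. \<sigma> x + lap u x)"
        proof (rule internal_edges_le)
          fix x assume "x \<in> ?T"
          then have "u x \<noteq> 0" using pos z by (auto simp: add.assoc)
          then show "0 < u x" using u0 [of x] by linarith
        qed (use st min fin in \<open>auto simp: \<sigma>_def\<close>)
        also have "\<dots> = (\<Sum>b\<in>A. \<sigma> (y + (z + b)) + lap u (y + (z + b)))"
          by (subst sum.reindex) (auto simp: inj_on_def add.assoc)
        also have "\<dots> = (\<Sum>b\<in>A. (int CARD('d) - 1) + int n * (if z = - (y + b) then 1 else 0) + lap u (y + (z + b)))"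
          by (intro sum.cong refl)
             (auto simp: \<sigma>_def const_plus_origin_def eq_neg_iff_add_eq_0 algebra_simps)
        also have "\<dots> = int (card A) * (int CARD('d) - 1) + int n * (\<Sum>b\<in>A. if z = - (y + b) then 1 else 0)
            + (\<Sum>b\<in>A. lap u (y + (z + b)))"
          by (simp add: sum.distrib sum_distrib_left)
        finally have "real_of_int (internal_edges A) \<le> real_of_int (int (card A) * (int CARD('d) - 1)
            + int n * (\<Sum>b\<in>A. if z = - (y + b) then 1 else 0) + (\<Sum>b\<in>A. lap u (y + (z + b))))"
          unfolding internal_edges_translate by (rule of_int_le_iff [THEN iffD2])
        also have "\<dots> = real (card A) * (d - 1) + real n * (\<Sum>b\<in>A. if z = - (y + b) then 1 else 0)
            + (\<Sum>b\<in>A. real_of_int (lap u (y + (z + b))))"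
        proof -
          have "real_of_int (if P then 1 else 0) = (if P then 1 else 0)" for P by simp
          then show ?thesis by (simp add: d_def)
        qed
        finally show ?thesis using k(2) by (simp add: A_def algebra_simps)
      qed
      define S where "S = (\<Sum>b\<in>A. if y + b \<in> Z then \<kappa> (y + b) else 0)"
      \<comment> \<open>By the symmetry of \<kappa> and \<open>Z\<close>, averaging moves the point
        source to the kernel restricted to \<open>Z\<close>, summed over \<open>A\<close>, exactly
        as in the bound for \<open>H\<close>.\<close>
      have delta: "(\<Sum>z\<in>Z. \<kappa> z * (\<Sum>b\<in>A. if z = - (y + b) then 1 else 0)) = S"
      proof -
        have "(\<Sum>z\<in>Z. \<kappa> z * (\<Sum>b\<in>A. if z = - (y + b) then 1 else 0))
            = (\<Sum>z\<in>Z. \<Sum>b\<in>A. if z = - (y + b) then \<kappa> z else 0)"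
          unfolding sum_distrib_left by (intro sum.cong refl) auto
        also have "\<dots> = (\<Sum>b\<in>A. \<Sum>z\<in>Z. if z = - (y + b) then \<kappa> z else 0)" by (rule sum.swap)
        also have "\<dots> = (\<Sum>b\<in>A. if - (y + b) \<in> Z then \<kappa> (- (y + b)) else 0)"
          by (intro sum.cong refl sum.delta fin(1))
        also have "\<dots> = S" unfolding S_def \<kappa>_even by (simp only: Z_def uminus_in_lball)
        finally show ?thesis .
      qed
      have "q * real (card A) = (1 - \<delta>) * q' * real (card A)" using \<delta> by simp
      also have "\<dots> < (\<Sum>z\<in>Z. \<kappa> z) * ((1 - \<delta>) * real (card A))"
      proof -
        have "0 < (1 - \<delta>) * real (card A)" using q q' cardA by (simp add: \<delta>_def)
        then have "q' * ((1 - \<delta>) * real (card A)) < (\<Sum>z\<in>Z. \<kappa> z) * ((1 - \<delta>) * real (card A))"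
          using \<rho>(2) by (intro mult_strict_right_mono) (auto simp: Z_def)
        then show ?thesis by (simp only: mult_ac)
      qed
      finally have strict: "q * real (card A) - real n * S < (\<Sum>z\<in>Z. \<kappa> z) * ((1 - \<delta>) * real (card A)) - real n * S"
        by simp
      also have "\<dots> = (\<Sum>z\<in>Z. \<kappa> z * ((1 - \<delta>) * real (card A) - real n * (\<Sum>b\<in>A. if z = - (y + b) then 1 else 0)))"
        unfolding delta [symmetric] by (simp add: right_diff_distrib sum_subtractf sum_distrib_left sum_distrib_right mult_ac)
      also have "\<dots> \<le> (\<Sum>z\<in>Z. \<kappa> z * (\<Sum>b\<in>A. real_of_int (lap u (y + (z + b)))))"
        using less_imp_le [OF \<kappa>] by (intro sum_mono mult_left_mono avg) auto
      also have "\<dots> = lap U y"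
        unfolding U_def by (simp only: lap_sum lap_cmult lap_of_int lap_shift [of u])
      finally have "q * real (card A) - real n * S < lap U y" .
      moreover have "lap H y \<le> q * real (card A) - real n * S"
      proof -
        have "lap H y = (\<Sum>b\<in>A. lap G (y + b))" unfolding H_def by (simp only: lap_sum lap_shift)
        also have "\<dots> \<le> (\<Sum>b\<in>A. q - real n * (if y + b \<in> Z then \<kappa> (y + b) else 0))"
          by (intro sum_mono lap_G)
        also have "\<dots> = q * real (card A) - real n * S"
          unfolding S_def sum_subtractf sum_distrib_left by (simp add: mult.commute)
        finally show ?thesis .
      qed
      ultimately show ?thesis by (simp add: lap_diff)
    qed
    have comparison: "U y \<le> H y + CB" for y
    proof (rule ccontr)
      define D where "D x = U x - H x" for x
      define S where "S = {x. CB < D x}"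
      assume "\<not> U y \<le> H y + CB"
      then have "y \<in> S" by (simp add: S_def D_def)
      \<comment> \<open>The average inherits finite support from \<open>u\<close>, so the difference
        attains its maximum on \<open>S\<close>.\<close>
      have "S \<subseteq> (\<Union>z\<in>Z. \<Union>b\<in>A. (\<lambda>x. x - (z + b)) ` {x. u x \<noteq> 0})"
      proof
        fix x assume "x \<in> S"
        then have "0 < U x" using H0 [of x] CB by (simp add: S_def D_def)
        have "\<exists>z\<in>Z. \<exists>b\<in>A. u (x + (z + b)) \<noteq> 0"
        proof (rule ccontr)
          assume "\<not> ?thesis"
          then have "U x = 0" unfolding U_def by simp
          then show False using \<open>0 < U x\<close> by simp
        qed
        then obtain z b where "z \<in> Z" "b \<in> A" "u (x + (z + b)) \<noteq> 0" by blast
        moreover have "x = (x + (z + b)) - (z + b)" by simp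
        ultimately show "x \<in> (\<Union>z\<in>Z. \<Union>b\<in>A. (\<lambda>x. x - (z + b)) ` {x. u x \<noteq> 0})" by blast
      qed
      then have "finite S" by (rule finite_subset) (use fin fin_u in auto)
      then have "Max (D ` S) \<in> D ` S" using \<open>y \<in> S\<close> by (intro Max_in) auto
      then obtain x0 where x0: "x0 \<in> S" "D x0 = Max (D ` S)" by auto
      have "D x \<le> D x0" for x
      proof (cases "x \<in> S")
        case True
        then show ?thesis using \<open>finite S\<close> by (simp add: x0)
      next
        case False
        then show ?thesis using x0(1) by (simp add: S_def)
      qed
      then have "lap D x0 \<le> lap (\<lambda>_. D x0) x0" by (intro lap_le) auto
      then have "\<not> 0 < lap D x0" by simp
      then have "\<exists>z\<in>Z. \<exists>b\<in>A. u (x0 + (z + b)) = 0" using good [of x0] unfolding D_def by blast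
      then have "U x0 \<le> CB" using bad by blast
      then show False using x0(1) H0 [of x0] by (simp add: S_def D_def)
    qed
    have "H x \<le> (\<Sum>b\<in>A. 2 * q)"
      unfolding H_def
    proof (intro sum_mono G_out)
      fix b assume "b \<in> A"
      then have "norm (rvec b) \<le> k" by (simp add: A_def lball_def)
      moreover have "norm (rvec x) \<le> norm (rvec (x + b)) + norm (rvec b)"
        using norm_triangle_ineq4 [of "rvec (x + b)" "rvec b"] by (simp add: rvec_add)
      ultimately show "R < norm (rvec (x + b))" using x by linarith
    qed
    then have "U x \<le> 2 * q * real (card A) + CB" using comparison [of x] by (simp add: mult.commute)
    \<comment> \<open>The average is undone by keeping only its term at z = b = 0.\<close>
    moreover have "\<kappa> 0 * real_of_int (u x) \<le> U x"
    proof -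
      have "real_of_int (u (x + (0 + 0))) \<le> (\<Sum>b\<in>A. real_of_int (u (x + (0 + b))))"
        using zero fin u0 by (intro member_le_sum) auto
      then have "\<kappa> 0 * real_of_int (u x) \<le> \<kappa> 0 * (\<Sum>b\<in>A. real_of_int (u (x + (0 + b))))"
        using less_imp_le [OF \<kappa> [of 0]] by (intro mult_left_mono) auto
      also have "\<dots> \<le> U x"
        unfolding U_def using zero fin u0 less_imp_le [OF \<kappa>]
        by (intro member_le_sum mult_nonneg_nonneg sum_nonneg) auto
      finally show ?thesis .
    qed
    ultimately have "\<kappa> 0 * real_of_int (u x) \<le> 2 * q * real (card A) + CB" by linarith
    then show ?thesis using \<kappa> [of 0] by (simp add: field_simps)
  qed
  show ?thesis
    by (intro exI [of _ "(2 * q * real (card A) + CB) / \<kappa> 0"] exI [of _ k] exI [of _ \<rho>] allI impI)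
       (rule main; blast)
qed

subsection \<open>Asymptotics\<close>

lemma eventually_le_root:
  assumes "0 < v" "0 < d"
  shows "\<forall>\<^sub>F n in sequentially. Y \<le> (real n / v) powr (1 / d)"
proof -
  obtain m :: nat where m: "v * \<bar>Y\<bar> powr d \<le> real m" using real_arch_simple by blast
  have "Y \<le> (real n / v) powr (1 / d)" if "m \<le> n" for n
  proof -
    have "\<bar>Y\<bar> powr d \<le> real n / v" using m that assms by (simp add: field_simps)
    then have "(\<bar>Y\<bar> powr d) powr (1 / d) \<le> (real n / v) powr (1 / d)"
      using assms by (intro powr_mono2) auto
    moreover have "(\<bar>Y\<bar> powr d) powr (1 / d) = \<bar>Y\<bar>" using assms by (simp add: powr_powr)
    ultimately show ?thesis by linarith
  qed
  then show ?thesis by (auto simp: eventually_sequentially)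
qed

lemma slab_stabilizer_eventually:
  assumes "1 < \<beta>"
  shows "\<forall>\<^sub>F n in sequentially. \<exists>R (u :: int ^ 'd::finite \<Rightarrow> int).
    stabilizes (const_plus_origin (int CARD('d) - 1) n) u \<and>
    (\<forall>i x. int R \<le> \<bar>x $ i\<bar> \<longrightarrow> u x = 0) \<and>
    real R \<le> \<beta> * (real n / unit_ball_vol (real CARD('d))) powr (1 / real CARD('d))"
proof -
  define d where "d = real CARD('d)"
  define v where "v = unit_ball_vol d"
  define X where "X n = (real n / v) powr (1 / d)" for n :: nat
  \<comment> \<open>Halfway between 1 and \<beta>: the factor \<mu> makes \<open>q\<close>
    subcritical, and the rest, (\<beta> - \<mu>) X, swallows the bounded widths \<open>k\<close> and
    \<open>J\<close> and the rounding.\<close>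
  define \<mu> where "\<mu> = (1 + \<beta>) / 2"
  define q where "q = d * v / \<mu> ^ CARD('d)"
  have d: "0 < d" by (simp add: d_def)
  have v: "0 < v" unfolding v_def using d by (intro unit_ball_vol_pos) simp
  have \<mu>: "1 < \<mu>" "\<mu> < \<beta>" using assms by (simp_all add: \<mu>_def)
  have "1 < \<mu> ^ CARD('d)" using \<mu> by (intro one_less_power) auto
  then have q: "0 < q" "q < d * v" using d v by (simp_all add: q_def divide_less_eq)
  obtain C k \<rho> where bound: "\<And>n R (u :: int ^ 'd \<Rightarrow> int) x. \<rho> \<le> R \<Longrightarrow>
      real n * d \<le> q * R ^ CARD('d) \<Longrightarrow> stabilizes (const_plus_origin (int CARD('d) - 1) n) u \<Longrightarrow>
      (\<forall>w x. stabilizes (const_plus_origin (int CARD('d) - 1) n) w \<longrightarrow> u x \<le> w x) \<Longrightarrow>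
      finite {x. u x \<noteq> 0} \<Longrightarrow> R + k < norm (rvec x) \<Longrightarrow> real_of_int (u x) \<le> C"
    using minimal_stabilizer_bounded [OF q [unfolded d_def v_def]] unfolding d_def by blast
  obtain m :: nat where m: "2 * C \<le> real m" using real_arch_simple by blast
  define J where "J = Suc m"
  have J: "2 * C \<le> real J * real J"
  proof -
    have "2 * C \<le> real J * 1" using m by (simp add: J_def)
    also have "\<dots> \<le> real J * real J" by (intro mult_left_mono) (auto simp: J_def)
    finally show ?thesis .
  qed
  have "\<forall>\<^sub>F n in sequentially. max \<bar>\<rho>\<bar> ((\<bar>k\<bar> + 2 + real J) / (\<beta> - \<mu>)) \<le> X n"
    unfolding X_def using v d by (rule eventually_le_root)
  then show ?thesis
  proof eventually_elim
    case (elim n)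
    define \<sigma> where "\<sigma> = (const_plus_origin (int CARD('d) - 1) n :: 'd config)"
    define R0 where "R0 = \<mu> * X n"
    \<comment> \<open>Nothing is known about the sign of \<open>k\<close>, hence the absolute value;
      the added 1 makes points at this distance strictly farther than R0 + k.\<close>
    define R1 where "R1 = nat \<lceil>R0 + \<bar>k\<bar>\<rceil> + 1"
    have X0: "0 \<le> X n" by (simp add: X_def)
    have "X n \<le> R0" unfolding R0_def using \<mu> X0 by (simp add: mult_le_cancel_right1)
    then have R0: "\<rho> \<le> R0" using elim by linarith
    have "X n ^ CARD('d) = real n / v"
      using v d by (cases "n = 0") (simp_all add: X_def d_def powr_power)
    then have "q * R0 ^ CARD('d) = real n * d"
      using \<mu> v by (simp add: q_def R0_def power_mult_distrib field_simps)
    then have nq: "real n * d \<le> q * R0 ^ CARD('d)" by simp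
    obtain u where u: "stabilizes \<sigma> u" and min: "\<And>w x. stabilizes \<sigma> w \<Longrightarrow> u x \<le> w x"
      using minimal_stabilizer_exists [OF stabilizes_tail_sum [where 'd = 'd, of n]] unfolding \<sigma>_def by blast
    have u0: "0 \<le> u x" for x using u by (simp add: stabilizes_def)
    have "u x = 0" if "int n \<le> \<bar>x $ i\<bar>" for x i
    proof -
      have "u x \<le> tail_sum (\<lambda>j. int CARD('d) * int (n - j)) n (x $ i)"
        by (rule min) (simp only: \<sigma>_def stabilizes_tail_sum)
      then show ?thesis using tail_sum_eq_0 [OF that] u0 [of x] by simp
    qed
    then have small: "\<bar>x $ i\<bar> < int n" if "u x \<noteq> 0" for x i using that by (meson not_le)
    have "{x. u x \<noteq> 0} \<subseteq> lball (d * real n)"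
    proof
      fix x assume "x \<in> {x. u x \<noteq> 0}"
      then have "\<bar>real_of_int (x $ i)\<bar> \<le> real n" for i using small [of x i] by simp
      then have "(\<Sum>i\<in>UNIV. \<bar>rvec x $ i\<bar>) \<le> (\<Sum>i\<in>(UNIV :: 'd set). real n)" by (intro sum_mono) simp
      then show "x \<in> lball (d * real n)"
        using norm_le_l1_cart [of "rvec x"] by (simp add: lball_def d_def)
    qed
    then have fin: "finite {x. u x \<noteq> 0}" by (rule finite_subset) simp
    have far: "2 * u x \<le> int J * int J" if "\<bar>x $ i\<bar> = int R1" for x i
    proof -
      have "real R1 \<le> norm (rvec x)"
        using component_le_norm_cart [of "rvec x" i] that by simp
      then have "R0 + k < norm (rvec x)" unfolding R1_def by linarith
      then have "real_of_int (u x) \<le> C"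
        using bound [OF R0 nq] u min fin unfolding \<sigma>_def by blast
      then have "real_of_int (2 * u x) \<le> real_of_int (int J * int J)" using J by simp
      then show ?thesis by (simp only: of_int_le_iff)
    qed
    have zero: "u x = 0" if "int (R1 + J) \<le> \<bar>x $ i\<bar>" for x i
      using minimal_stabilizer_slab [of n u i R1 J x] u min far that unfolding \<sigma>_def by blast
    have "(\<bar>k\<bar> + 2 + real J) / (\<beta> - \<mu>) \<le> X n" using elim by simp
    then have "\<bar>k\<bar> + 2 + real J \<le> (\<beta> - \<mu>) * X n" using \<mu> by (simp add: divide_le_eq mult.commute)
    moreover have "0 \<le> R0" using X0 \<mu> by (simp add: R0_def)
    then have "real R1 \<le> R0 + \<bar>k\<bar> + 2" unfolding R1_def by linarith
    ultimately have "real (R1 + J) \<le> \<beta> * X n" by (simp add: R0_def algebra_simps)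
    then show ?case
      using u zero unfolding \<sigma>_def X_def v_def d_def by blast
  qed
qed

section \<open>From slabs to the cube\<close>

lemma cube_iff: "x \<in> cube r \<longleftrightarrow> (\<forall>i. real_of_int \<bar>x $ i\<bar> \<le> r)"
proof -
  have "Max (range (\<lambda>i. \<bar>x $ i\<bar>)) \<in> range (\<lambda>i. \<bar>x $ i\<bar>)" by (intro Max_in) auto
  then obtain j where j: "Max (range (\<lambda>i. \<bar>x $ i\<bar>)) = \<bar>x $ j\<bar>" by blast
  have "\<bar>x $ i\<bar> \<le> \<bar>x $ j\<bar>" for i unfolding j [symmetric] by (intro Max_ge) auto
  then show ?thesis unfolding cube_def mem_Collect_eq j by (meson of_int_le_iff order_trans)
qed

theorem theorem1p1:
  fixes h :: int and \<epsilon> :: real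
  assumes "int CARD('d::finite) \<le> h" and "h \<le> 2 * int CARD('d) - 2"
    and "\<epsilon> > 0"
  shows "\<forall>\<^sub>F n in sequentially.
    toppled_sites (const_plus_origin h n :: 'd config) \<subseteq>
      cube ((real CARD('d) + \<epsilon>) / (2 * real CARD('d) - 1 - real_of_int h) *
            (real n / measure lborel (ball (0 :: real ^ 'd) 1)) powr (1 / real CARD('d)))"
proof -
  define d where "d = real CARD('d)"
  define v where "v = unit_ball_vol d"
  define X where "X n = (real n / v) powr (1 / d)" for n :: nat
  define k where "k = h - (int CARD('d) - 1)"
  define a where "a = 2 * int CARD('d) - 1 - h"
  have d: "0 < d" by (simp add: d_def)
  have v: "0 < v" unfolding v_def using d by (intro unit_ball_vol_pos) simp
  have vol: "measure lborel (ball (0 :: real ^ 'd) 1) = v"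
    by (simp add: content_ball v_def d_def)
  have k: "0 \<le> k" and a: "1 \<le> a" and ka: "k + a = int CARD('d)" and h: "h = int CARD('d) - 1 + k"
    using assms by (simp_all add: k_def a_def)
  have ra: "real_of_int a = 2 * real CARD('d) - 1 - real_of_int h" by (simp add: a_def)
  have rka: "real_of_int k + real_of_int a = d"
    using arg_cong [OF ka, of real_of_int] by (simp add: d_def)
  \<comment> \<open>Half of \<epsilon> goes into d \<beta> = d + \<epsilon> / 2; the other half pays
    for the rounding term k + 2 a once X is large.\<close>
  define \<beta> where "\<beta> = 1 + \<epsilon> / (2 * d)"
  have \<beta>: "1 < \<beta>" using assms(3) d by (simp add: \<beta>_def)
  have "\<forall>\<^sub>F n in sequentially. 2 * (real_of_int k + 2 * real_of_int a) / \<epsilon> \<le> X n"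
    unfolding X_def using v d by (rule eventually_le_root)
  with slab_stabilizer_eventually [OF \<beta>, where 'd = 'd] show ?thesis
  proof eventually_elim
    case (elim n)
    then obtain R and u :: "int ^ 'd \<Rightarrow> int"
      where u: "stabilizes (const_plus_origin (int CARD('d) - 1) n) u"
        and u0: "\<And>i x. int R \<le> \<bar>x $ i\<bar> \<Longrightarrow> u x = 0" and R: "real R \<le> \<beta> * X n"
      unfolding X_def v_def d_def by blast
    \<comment> \<open>The slopes of the profile need about k (R + 1) / a steps to fall back to 0;
      since k + a = d, the total distance is d R / a up to a constant.\<close>
    define L where "L = R + nat \<lceil>real_of_int k * (real R + 1) / real_of_int a\<rceil> + 1"
    have t0: "0 \<le> real_of_int k * (real R + 1) / real_of_int a" using k a by simp
    have L_ge: "real_of_int k * (real R + 1) / real_of_int a \<le> real L - real R"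
      unfolding L_def by linarith
    then have "real_of_int k * (real R + 1) \<le> real_of_int a * (real L - real R)"
      using a by (simp add: divide_le_eq mult.commute)
    then have "real_of_int (k * (int R + 1)) \<le> real_of_int (a * (int L - int R))" by simp
    then have L: "R < L" "k * (int R + 1) \<le> a * (int L - int R)"
      by (simp add: L_def, simp only: of_int_le_iff)
    have "real L \<le> real R + real_of_int k * (real R + 1) / real_of_int a + 2"
      unfolding L_def using t0 by linarith
    then have "real L * real_of_int a \<le> (real R + real_of_int k * (real R + 1) / real_of_int a + 2) * real_of_int a"
      using a by (intro mult_right_mono) auto
    also have "\<dots> = (real_of_int k + real_of_int a) * real R + (real_of_int k + 2 * real_of_int a)"
      using a by (simp add: field_simps)
    also have "\<dots> \<le> d * (\<beta> * X n) + \<epsilon> / 2 * X n"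
    proof (rule add_mono)
      show "(real_of_int k + real_of_int a) * real R \<le> d * (\<beta> * X n)"
        unfolding rka using R d by (intro mult_left_mono) auto
      show "real_of_int k + 2 * real_of_int a \<le> \<epsilon> / 2 * X n"
        using elim(2) assms(3) by (simp add: divide_le_eq mult.commute)
    qed
    also have "\<dots> = (d + \<epsilon>) * X n" using d by (simp add: \<beta>_def field_simps)
    finally have bound: "real L \<le> (d + \<epsilon>) / real_of_int a * X n" using a by (simp add: field_simps)
    have "\<bar>x $ i\<bar> < int L" if x: "x \<in> toppled_sites (const_plus_origin h n :: 'd config)" for x i
    proof -
      obtain w where w: "stabilizes (const_plus_origin (int CARD('d) - 1 + k) n) w"
        "\<And>x. int L \<le> \<bar>x $ i\<bar> \<Longrightarrow> w x = 0"
        using stabilizes_raise_background [OF u u0 [where i = i] k _ ka L] a by auto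
      then have "0 < w x" by (intro toppled_sites_pos [OF x]) (simp add: h)
      then show ?thesis using w(2) [of x] by linarith
    qed
    then have "real_of_int \<bar>x $ i\<bar> \<le> (d + \<epsilon>) / real_of_int a * X n"
      if "x \<in> toppled_sites (const_plus_origin h n :: 'd config)" for x i
      using that bound by (smt (verit) of_int_less_iff of_int_of_nat_eq)
    then show ?case unfolding vol ra [symmetric] by (auto simp: cube_iff X_def d_def)
  qed
qed

end
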